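(* Assume: (1) $(X_i,Y_i)_{i=1}^n$ are i.i.d. copies of $(X,Y)$, where $Y=\langle\beta,X\rangle+\varepsilon$ with $\mathbb{E}[\varepsilon X]=0$, $\mathbb{E}[X]=0$, $\mathbb{E}\|X\|^4<\infty$ and $\mathbb{E}[\varepsilon^2\mid X]\le\sigma^2<\infty$; (2) the covariance operator $K=\mathbb{E}[X\otimes X]$ has no zero eigenvalues; (3) the PLS estimator $\hat\beta_m$ is computed using a number of components $m=m_n\ge1$ such that $\|\hat r-\hat K\hat\beta_m\|=o_P(n^{-1/2})$. Let $b\in\mathbb{H}$ be known, $T_n=n\|\hat K(\hat\beta_m-b)\|^2$, $\alpha\in(0,1)$, and let $z_{1-\alpha}$ be the $(1-\alpha)$-quantile of $T=\sum_{j=1}^\infty\omega_jZ_j^2$. Then: (a) under $H_0:\beta=b$, $\lim_{n\to\infty}\Pr(T_n>z_{1-\alpha})=\alpha$; (b) under $H_1:\beta\ne b$ (fixed), $\lim_{n\to\infty}\Pr(T_n>z_{1-\alpha})=1$; (c) under the local alternatives $H_{1,n}:\beta=b+n^{-1/2}\Delta$, $\Delta\in\mathbb{H}$, the limit $\lim_{n\to\infty}\Pr(T_n>z_{1-\alpha})$ tends (from below) to $1$ as $\|K\Delta\|\to\infty$.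
   Context: $(\mathbb{H},\langle\cdot,\cdot\rangle)$ is a separable real Hilbert space with norm $\|\cdot\|$; $X,\beta\in\mathbb{H}$, $Y,\varepsilon\in\mathbb{R}$. For $x\in\mathbb{H}$, $(x\otimes x)b=\langle x,b\rangle x$. Sample quantities: $\hat r=\frac1n\sum_{i=1}^nY_iX_i$, $\hat K=\frac1n\sum_{i=1}^nX_i\otimes X_i$. PLS estimator: for $m\ge1$, $\hat\beta_m$ is the minimizer of $\|\hat r-\hat Kb\|^2$ over $b$ in the Krylov subspace $\mathbb{H}_m=\mathrm{span}\{\hat r,\hat K\hat r,\dots,\hat K^{m-1}\hat r\}$. $V=\mathbb{E}[\varepsilon^2X\otimes X]=\sum_{j\ge1}\omega_j\varphi_j\otimes\varphi_j$ is the variance operator in its spectral decomposition, and $(Z_j)_{j\ge1}$ are i.i.d. $N(0,1)$. The quantile $z_{1-\alpha}$ satisfies $\Pr(T\le z_{1-\alpha})=1-\alpha$. Under $H_{1,n}$ the sample of size $n$ is generated by $Y_i=\langle b+n^{-1/2}\Delta,X_i\rangle+\varepsilon_i$, with the distribution of $(X_i,\varepsilon_i)$ not depending on $n$. *)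

theory Defs
  imports "HOL-Probability.Probability"
begin

text \<open>
  A separable real Hilbert space is a type of sort
  \<open>{real_inner, banach, second_countable_topology}\<close>.
\<close>

definition tensor_square :: "'h::real_inner \<Rightarrow> 'h \<Rightarrow> 'h" where
  "tensor_square x b = (x \<bullet> b) *\<^sub>R x"

definition is_eigenvalue :: "('h::real_vector \<Rightarrow> 'h) \<Rightarrow> real \<Rightarrow> bool" where
  "is_eigenvalue A c \<longleftrightarrow> (\<exists>v. v \<noteq> 0 \<and> A v = c *\<^sub>R v)"


section \<open>Population quantities\<close>

text \<open>
  The space of bounded operators is not separable, so operator-valued Bochner integrals are not
  available; expectations of random operators are taken pointwise, as \<open>E[A] b = E[A b]\<close>
  with a Bochner integral in the Hilbert space. Under a finite fourth moment of \<open>X\<close> and a bounded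
  conditional second moment of \<open>eps\<close> all these integrals exist.
\<close>

definition cov_operator ::
  "'w measure \<Rightarrow> ('w \<Rightarrow> 'h::{real_inner,banach,second_countable_topology}) \<Rightarrow> 'h \<Rightarrow> 'h" where
  "cov_operator M X b = (\<integral>w. tensor_square (X w) b \<partial>M)"

definition var_operator ::
  "'w measure \<Rightarrow> ('w \<Rightarrow> 'h::{real_inner,banach,second_countable_topology})
    \<Rightarrow> ('w \<Rightarrow> real) \<Rightarrow> 'h \<Rightarrow> 'h" where
  "var_operator M X eps b = (\<integral>w. (eps w)\<^sup>2 *\<^sub>R tensor_square (X w) b \<partial>M)"

text \<open>
  The index starts at 0. Orthonormality is only required of the eigenvectors belonging to nonzero
  \<open>\<omega> j\<close>, so that an operator of finite rank (in particular, on a finite-dimensional space) also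
  has decompositions in this sense, padded with zeros.
\<close>

definition spectral_decomposition ::
  "('h::real_inner \<Rightarrow> 'h) \<Rightarrow> (nat \<Rightarrow> real) \<Rightarrow> (nat \<Rightarrow> 'h) \<Rightarrow> bool" where
  "spectral_decomposition A \<omega> \<phi> \<longleftrightarrow>
     (\<forall>j. 0 \<le> \<omega> j) \<and>
     (\<forall>i j. \<omega> i \<noteq> 0 \<longrightarrow> \<omega> j \<noteq> 0 \<longrightarrow> \<phi> i \<bullet> \<phi> j = (if i = j then 1 else 0)) \<and>
     (\<forall>b. (\<lambda>j. \<omega> j *\<^sub>R tensor_square (\<phi> j) b) sums A b)"

text \<open>
  The conditional expectation of the nonnegative \<open>eps\<^sup>2\<close> given (the sigma-algebra generated by)
  \<open>X\<close> is taken in \<open>[0, \<infinity>]\<close>; the bound by \<open>\<sigma>\<^sup>2\<close> makes \<open>eps\<close> square integrable.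
\<close>

definition regression_model ::
  "'w measure \<Rightarrow> ('w \<Rightarrow> 'h::{real_inner,banach,second_countable_topology})
    \<Rightarrow> ('w \<Rightarrow> real) \<Rightarrow> real \<Rightarrow> bool" where
  "regression_model M X eps \<sigma> \<longleftrightarrow>
     prob_space M \<and>
     X \<in> borel_measurable M \<and> eps \<in> borel_measurable M \<and>
     (\<integral>w. eps w *\<^sub>R X w \<partial>M) = 0 \<and>
     (\<integral>w. X w \<partial>M) = 0 \<and>
     integrable M (\<lambda>w. norm (X w) ^ 4) \<and>
     (AE w in M. nn_cond_exp M (vimage_algebra (space M) X borel)
                   (\<lambda>w. ennreal ((eps w)\<^sup>2)) w \<le> ennreal (\<sigma>\<^sup>2))"


section \<open>Sample quantities and the PLS estimator\<close>

text \<open>A sample of size \<open>n\<close> is a pair of functions \<open>xs\<close>, \<open>ys\<close>, read on \<open>{1..n}\<close>.\<close>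

definition sample_r :: "nat \<Rightarrow> (nat \<Rightarrow> 'h::real_inner) \<Rightarrow> (nat \<Rightarrow> real) \<Rightarrow> 'h" where
  "sample_r n xs ys = (1 / real n) *\<^sub>R (\<Sum>i=1..n. ys i *\<^sub>R xs i)"

definition sample_K :: "nat \<Rightarrow> (nat \<Rightarrow> 'h::real_inner) \<Rightarrow> 'h \<Rightarrow> 'h" where
  "sample_K n xs b = (1 / real n) *\<^sub>R (\<Sum>i=1..n. tensor_square (xs i) b)"

definition krylov :: "('h::real_vector \<Rightarrow> 'h) \<Rightarrow> 'h \<Rightarrow> nat \<Rightarrow> 'h set" where
  "krylov A r m = span ((\<lambda>j. (A ^^ j) r) ` {..<m})"

definition pls_estimator :: "nat \<Rightarrow> nat \<Rightarrow> (nat \<Rightarrow> 'h::real_inner) \<Rightarrow> (nat \<Rightarrow> real) \<Rightarrow> 'h" where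
  "pls_estimator m n xs ys =
     arg_min (\<lambda>b. (norm (sample_r n xs ys - sample_K n xs b))\<^sup>2)
             (\<lambda>b. b \<in> krylov (sample_K n xs) (sample_r n xs ys) m)"

definition pls_residual :: "nat \<Rightarrow> nat \<Rightarrow> (nat \<Rightarrow> 'h::real_inner) \<Rightarrow> (nat \<Rightarrow> real) \<Rightarrow> real" where
  "pls_residual m n xs ys =
     norm (sample_r n xs ys - sample_K n xs (pls_estimator m n xs ys))"

definition pls_statistic ::
  "'h \<Rightarrow> nat \<Rightarrow> nat \<Rightarrow> (nat \<Rightarrow> 'h::real_inner) \<Rightarrow> (nat \<Rightarrow> real) \<Rightarrow> real" where
  "pls_statistic b m n xs ys =
     real n * (norm (sample_K n xs (pls_estimator m n xs ys - b)))\<^sup>2"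


text \<open>
  The minimizer defining the estimator exists and is unique for every sample, so the choice
  made by \<^const>\<open>arg_min\<close> is immaterial.
\<close>

lemma linear_sample_K: "linear (sample_K n (xs :: nat \<Rightarrow> 'h::real_inner))"
proof -
  have lin: "linear (tensor_square x)" for x :: 'h
    by (rule linearI)
       (simp_all add: tensor_square_def inner_add_right scaleR_left_distrib)
  have "linear (\<lambda>b. \<Sum>i=1..n. tensor_square (xs i) b)"
    using lin by (intro linear_compose_sum) blast
  then show ?thesis
    unfolding sample_K_def[abs_def] by (rule linear_compose_scale_right)
qed

lemma nearest_point_span:
  fixes B :: "'h::real_inner set"
  assumes "finite B"
  obtains p where "p \<in> span B" "\<And>q. q \<in> span B \<Longrightarrow> (a - p) \<bullet> q = 0"
proof -
  obtain C where C: "finite C" "span C = span B" "pairwise orthogonal C"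
    using basis_orthogonal[OF assms] by blast
  define p where "p = (\<Sum>c\<in>C. (a \<bullet> c / (c \<bullet> c)) *\<^sub>R c)"
  have "p \<in> span B"
    unfolding p_def C(2)[symmetric] by (intro span_sum span_scale span_base)
  moreover have "(a - p) \<bullet> q = 0" if "q \<in> span B" for q
  proof -
    have "q \<in> span C" using that C(2) by simp
    then have "orthogonal (a - p) q"
    proof (rule orthogonal_to_span)
      fix d assume d: "d \<in> C"
      have "p \<bullet> d = (\<Sum>c\<in>C. if c = d then a \<bullet> d else 0)"
        unfolding p_def inner_sum_left
        using C(3) d by (intro sum.cong) (auto simp: pairwise_def orthogonal_def)
      then show "orthogonal (a - p) d"
        using d C(1) by (simp add: orthogonal_def inner_diff_left)
    qed
    then show ?thesis by (simp add: orthogonal_def)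
  qed
  ultimately show ?thesis using that by blast
qed

lemma krylov_subset_span_sample:
  "krylov (sample_K n xs) (sample_r n xs ys) m \<subseteq> span (xs ` {1..n})"
proof -
  have K: "sample_K n xs b \<in> span (xs ` {1..n})" for b
    unfolding sample_K_def tensor_square_def by (intro span_scale span_sum span_base) auto
  have r: "sample_r n xs ys \<in> span (xs ` {1..n})"
    unfolding sample_r_def by (intro span_scale span_sum span_base) auto
  have "(sample_K n xs ^^ j) (sample_r n xs ys) \<in> span (xs ` {1..n})" for j
    using K r by (cases j) (simp_all del: One_nat_def)
  then show ?thesis
    unfolding krylov_def by (intro span_minimal) auto
qed

lemma sample_K_inj_on_span:
  assumes "b \<in> span (xs ` {1..n})" "sample_K n xs b = 0"
  shows "b = 0"
proof (cases "n = 0")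
  case False
  have "(\<Sum>i=1..n. (xs i \<bullet> b)\<^sup>2) = real n * (sample_K n xs b \<bullet> b)"
    using False by (simp add: sample_K_def tensor_square_def inner_sum_left power2_eq_square)
  then have "(\<Sum>i=1..n. (xs i \<bullet> b)\<^sup>2) = 0" using assms(2) by simp
  then have "\<forall>i\<in>{1..n}. (xs i \<bullet> b)\<^sup>2 = 0"
    by (subst (asm) sum_nonneg_eq_0_iff) auto
  then have *: "orthogonal b x" if "x \<in> xs ` {1..n}" for x
    using that by (auto simp: orthogonal_def inner_commute)
  have "orthogonal b b" using assms(1) * by (rule orthogonal_to_span)
  then show ?thesis by (simp add: orthogonal_def)
qed (use assms in simp)

lemma ex1_pls_minimizer:
  "\<exists>!b. is_arg_min (\<lambda>b. (norm (sample_r n xs ys - sample_K n xs b))\<^sup>2)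
          (\<lambda>b. b \<in> krylov (sample_K n xs) (sample_r n xs ys) m) b"
proof -
  define r where "r = sample_r n xs ys"
  define K where "K = sample_K n xs"
  define B where "B = (\<lambda>j. (K ^^ j) r) ` {..<m}"
  have kr: "krylov K r m = span B" by (simp add: krylov_def B_def)
  have lin: "linear K" by (simp add: K_def linear_sample_K)
  have img: "K ` span B = span (K ` B)"
    using lin by (simp add: linear_span_image)
  obtain p where p: "p \<in> span (K ` B)" "\<And>q. q \<in> span (K ` B) \<Longrightarrow> (r - p) \<bullet> q = 0"
    by (rule nearest_point_span[of "K ` B" r]) (auto simp: B_def)
  have "p \<in> K ` span B" using p(1) img by simp
  then obtain b0 where b0: "b0 \<in> span B" "K b0 = p" by (elim imageE) simp
  have pyth: "(norm (r - K b))\<^sup>2 = (norm (r - p))\<^sup>2 + (norm (p - K b))\<^sup>2" if "b \<in> span B" for b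
  proof -
    have "p - K b \<in> span (K ` B)" using p(1) that img by (intro span_diff) auto
    then have "orthogonal (r - p) (p - K b)" using p(2) by (simp add: orthogonal_def)
    from norm_add_Pythagorean[OF this] show ?thesis by simp
  qed
  have inj: "b = b0" if "b \<in> span B" "K b = p" for b
  proof -
    have "b - b0 \<in> span B" using that b0 by (intro span_diff)
    then have "b - b0 \<in> span (xs ` {1..n})"
      using krylov_subset_span_sample[of n xs ys m] kr by (auto simp: r_def K_def)
    moreover have "K (b - b0) = 0" using that b0 lin by (simp add: linear_diff)
    ultimately show ?thesis using sample_K_inj_on_span[of "b - b0" xs n] by (simp add: K_def)
  qed
  have "\<exists>!b. is_arg_min (\<lambda>b. (norm (r - K b))\<^sup>2) (\<lambda>b. b \<in> span B) b"
  proof (rule ex1I[of _ b0])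
    show "is_arg_min (\<lambda>b. (norm (r - K b))\<^sup>2) (\<lambda>b. b \<in> span B) b0"
      unfolding is_arg_min_linorder using b0 pyth by auto
  next
    fix b assume "is_arg_min (\<lambda>b. (norm (r - K b))\<^sup>2) (\<lambda>b. b \<in> span B) b"
    then have b: "b \<in> span B" "(norm (r - K b))\<^sup>2 \<le> (norm (r - K b0))\<^sup>2"
      unfolding is_arg_min_linorder using b0 by auto
    then have "(norm (p - K b))\<^sup>2 \<le> 0" using pyth[OF b(1)] b0 by simp
    then show "b = b0" using inj b(1) by simp
  qed
  then show ?thesis using kr by (simp add: r_def K_def)
qed


section \<open>The sampling scheme\<close>

definition iid_copies ::
  "'s measure \<Rightarrow> nat \<Rightarrow> (nat \<Rightarrow> 's \<Rightarrow> 'b::topological_space) \<Rightarrow> 'w measure \<Rightarrow> ('w \<Rightarrow> 'b) \<Rightarrow> bool" where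
  "iid_copies S n Z M W \<longleftrightarrow>
     prob_space S \<and>
     prob_space.indep_vars S (\<lambda>_. borel) Z {1..n} \<and>
     (\<forall>i\<in>{1..n}. distr S borel (Z i) = distr M borel W)"

text \<open>\<open>W n = o\<^sub>P(a n)\<close>, the \<open>n\<close>-th variable living on the probability space \<open>S n\<close>.\<close>

definition small_oP :: "(nat \<Rightarrow> 's measure) \<Rightarrow> (nat \<Rightarrow> 's \<Rightarrow> real) \<Rightarrow> (nat \<Rightarrow> real) \<Rightarrow> bool" where
  "small_oP S W a \<longleftrightarrow>
     (\<forall>c>0. (\<lambda>n. measure (S n) {s \<in> space (S n). \<bar>W n s\<bar> > c * a n}) \<longlonglongrightarrow> 0)"

text \<open>
  For each \<open>n\<close>, the sample of size \<open>n\<close> consists of i.i.d. copies of \<open>(X, Y)\<close> with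
  \<open>Y = \<beta> n \<bullet> X + eps\<close>. A constant sequence \<open>\<beta>\<close> gives a fixed coefficient; a single infinite
  i.i.d. sequence is the case where \<open>S n\<close>, \<open>Xs n\<close>, \<open>Ys n\<close> do not depend on \<open>n\<close>. The number of
  components \<open>m n\<close> may be chosen from the data; a deterministic choice is a constant \<open>m n\<close>.
\<close>

definition pls_sampling ::
  "'w measure \<Rightarrow> ('w \<Rightarrow> 'h::{real_inner,banach,second_countable_topology}) \<Rightarrow> ('w \<Rightarrow> real)
    \<Rightarrow> (nat \<Rightarrow> 'h) \<Rightarrow> (nat \<Rightarrow> 's measure) \<Rightarrow> (nat \<Rightarrow> nat \<Rightarrow> 's \<Rightarrow> 'h)
    \<Rightarrow> (nat \<Rightarrow> nat \<Rightarrow> 's \<Rightarrow> real) \<Rightarrow> (nat \<Rightarrow> 's \<Rightarrow> nat) \<Rightarrow> bool" where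
  "pls_sampling M X eps \<beta> S Xs Ys m \<longleftrightarrow>
     (\<forall>n\<ge>1. iid_copies (S n) n (\<lambda>i s. (Xs n i s, Ys n i s)) M (\<lambda>w. (X w, \<beta> n \<bullet> X w + eps w))
           \<and> m n \<in> measurable (S n) (count_space UNIV)
           \<and> (\<forall>s\<in>space (S n). 1 \<le> m n s)) \<and>
     small_oP S (\<lambda>n s. pls_residual (m n s) n (\<lambda>i. Xs n i s) (\<lambda>i. Ys n i s))
       (\<lambda>n. real n powr (-1/2))"

definition rejection_prob ::
  "'h::real_inner \<Rightarrow> real \<Rightarrow> (nat \<Rightarrow> 's measure) \<Rightarrow> (nat \<Rightarrow> nat \<Rightarrow> 's \<Rightarrow> 'h)
    \<Rightarrow> (nat \<Rightarrow> nat \<Rightarrow> 's \<Rightarrow> real) \<Rightarrow> (nat \<Rightarrow> 's \<Rightarrow> nat) \<Rightarrow> nat \<Rightarrow> real" where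
  "rejection_prob b z S Xs Ys m n =
     measure (S n) {s \<in> space (S n).
       pls_statistic b (m n s) n (\<lambda>i. Xs n i s) (\<lambda>i. Ys n i s) > z}"

end

theory Submission
  imports Defs
begin

text \<open>
  Write \<open>K\<^sub>n\<close> and \<open>r\<^sub>n\<close> for the sample versions of the covariance operator \<open>K\<close> and of
  \<open>E (Y X)\<close>. If \<open>\<beta>\<^sub>n\<close> is the true coefficient and \<open>\<rho>\<^sub>n\<close> the residual of the estimator, then
  \<open>sqrt n * K\<^sub>n (estimator - b) = G\<^sub>n - sqrt n * \<rho>\<^sub>n + sqrt n * K\<^sub>n (\<beta>\<^sub>n - b)\<close>,
  where \<open>G\<^sub>n\<close> is the normalized sum of the vectors \<open>eps\<^sub>i X\<^sub>i\<close> (\<open>deviation_eq\<close>). The statistic is the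
  squared norm of the left-hand side. The residual term is negligible by assumption, and
  \<open>K\<^sub>n d - K d\<close> is of order \<open>1 / sqrt n\<close> because \<open>X\<close> has a fourth moment. Hence a
  fixed alternative adds a drift \<open>sqrt n * K (\<beta> - b)\<close>, which is nonzero since \<open>K\<close> is injective, to
  bounded terms (\<open>rejection_prob_fixed_alternative\<close>). Local alternatives lead to the
  limit law of \<open>\<parallel>G\<^sub>n + K \<Delta>\<parallel>\<^sup>2\<close> (\<open>rejection_prob_local_alternative\<close>), and the null hypothesis is the case
  \<open>\<Delta> = 0\<close>.

  It remains to find the limit law of \<open>\<parallel>G\<^sub>n + h\<parallel>\<^sup>2\<close>. The Laplace transform of a squared norm is a
  Gaussian mixture of characteristic functions of linear functionals
  (\<open>expectation_exp_square_mixing\<close>), and for those the one-dimensional central limit theorem applies.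
  This handles finitely many coordinates with respect to the eigenvectors of the variance operator.
  The other coordinates contribute little, uniformly in \<open>n\<close>, because the noise lies in the closed span
  of the eigenvectors and the variance operator has finite trace (\<open>ortho_trunc_tendsto\<close>,
  \<open>tail_tendsto_0\<close>). The Laplace transform at the natural numbers consists of the moments of a
  variable in \<open>[0, 1]\<close> and so determines the limit in distribution
  (\<open>exp_moments_imp_prob_greater_tendsto\<close>).

  The limit variable is \<open>\<parallel>G + h\<parallel>\<^sup>2\<close> for the Gaussian vector \<open>G\<close> with the same covariance, written as
  the series \<open>limit_var h\<close>; for \<open>h = 0\<close> it is the variable whose quantile is used. It has no atoms
  (\<open>limit_var_no_atom\<close>), so the rejection probabilities converge, and it is at least
  \<open>\<parallel>h\<parallel>\<^sup>2 / 2\<close> minus a fixed random variable (\<open>limit_var_lower_bound\<close>), so the limiting power tends to 1.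
\<close>

section \<open>Measurability of the PLS fit\<close>

text \<open>
  \<open>gram_schmidt_proj v k x\<close> is the orthogonal projection of \<open>x\<close> onto the span of
  \<open>v 0, \<dots>, v (k - 1)\<close>. It is written as a recursion, rather than as a nearest point,
  because every step is an explicit Borel function of the vectors. When \<open>v k\<close> already lies in
  the span of its predecessors, the new direction and the inner product below the fraction bar
  vanish, and division by zero leaves the projection unchanged.
\<close>

primrec gram_schmidt_proj :: "(nat \<Rightarrow> 'h::real_inner) \<Rightarrow> nat \<Rightarrow> 'h \<Rightarrow> 'h" where
  "gram_schmidt_proj v 0 x = 0"
| "gram_schmidt_proj v (Suc k) x = gram_schmidt_proj v k x +
     ((x \<bullet> (v k - gram_schmidt_proj v k (v k))) /
      ((v k - gram_schmidt_proj v k (v k)) \<bullet> (v k - gram_schmidt_proj v k (v k)))) *\<^sub>R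
     (v k - gram_schmidt_proj v k (v k))"

lemma gram_schmidt_proj_orthogonal:
  fixes v :: "nat \<Rightarrow> 'h::real_inner"
  shows "gram_schmidt_proj v k x \<in> span (v ` {..<k})
       \<and> (\<forall>q\<in>span (v ` {..<k}). (x - gram_schmidt_proj v k x) \<bullet> q = 0)"
proof (induction k arbitrary: x)
  case 0
  show ?case by simp
next
  case (Suc k)
  define u where "u = v k - gram_schmidt_proj v k (v k)"
  define c where "c = (x \<bullet> u) / (u \<bullet> u)"
  let ?S = "span (v ` {..<k})" and ?S' = "span (v ` {..<Suc k})"
  have sub: "?S \<subseteq> ?S'" by (intro span_mono) auto
  have vk: "v k \<in> ?S'" by (intro span_base) auto
  have P: "gram_schmidt_proj v k y \<in> ?S" for y using Suc.IH by blast
  have eq: "gram_schmidt_proj v (Suc k) x = gram_schmidt_proj v k x + c *\<^sub>R u"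
    by (simp add: u_def c_def)
  have u_orth: "u \<bullet> q = 0" if "q \<in> ?S" for q
    using Suc.IH[of "v k"] that by (simp add: u_def)
  have "gram_schmidt_proj v (Suc k) x \<in> ?S'"
    unfolding eq u_def using P sub vk by (intro span_add span_scale span_diff) auto
  moreover have "(x - gram_schmidt_proj v (Suc k) x) \<bullet> q = 0" if q: "q \<in> ?S'" for q
  proof -
    obtain a where a: "q - a *\<^sub>R v k \<in> ?S"
      using q by (auto simp: lessThan_Suc span_insert)
    define q1 where "q1 = (q - a *\<^sub>R v k) + a *\<^sub>R gram_schmidt_proj v k (v k)"
    have q1: "q1 \<in> ?S" unfolding q1_def using a P by (intro span_add span_scale)
    have qe: "q = q1 + a *\<^sub>R u" by (simp add: q1_def u_def algebra_simps)
    have 1: "(x - gram_schmidt_proj v k x) \<bullet> q1 = 0" using Suc.IH[of x] q1 by blast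
    have 2: "u \<bullet> q1 = 0" using u_orth q1 .
    have 3: "gram_schmidt_proj v k x \<bullet> u = 0" using u_orth[OF P] by (simp add: inner_commute)
    have 4: "(x - gram_schmidt_proj v (Suc k) x) \<bullet> u = 0"
      using 3 unfolding eq by (simp add: c_def inner_diff_left inner_add_left)
    have 5: "(x - gram_schmidt_proj v (Suc k) x) \<bullet> q1 = 0"
      using 1 2 unfolding eq by (simp add: inner_diff_left inner_add_left)
    show ?thesis using 4 5 by (simp add: qe inner_add_right)
  qed
  ultimately show ?case by blast
qed

lemma borel_measurable_gram_schmidt_proj:
  fixes v :: "nat \<Rightarrow> 's \<Rightarrow> 'h::{real_inner,second_countable_topology}"
  assumes v [measurable]: "\<And>j. v j \<in> borel_measurable S"
    and x: "x \<in> borel_measurable S"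
  shows "(\<lambda>s. gram_schmidt_proj (\<lambda>j. v j s) k (x s)) \<in> borel_measurable S"
  using x
proof (induction k arbitrary: x)
  case (Suc k)
  have [measurable]: "(\<lambda>s. gram_schmidt_proj (\<lambda>j. v j s) k (x s)) \<in> borel_measurable S"
    "(\<lambda>s. gram_schmidt_proj (\<lambda>j. v j s) k (v k s)) \<in> borel_measurable S"
    "x \<in> borel_measurable S"
    using Suc v by auto
  show ?case by simp
qed simp

text \<open>
  The estimator itself is an \<^const>\<open>arg_min\<close>, whose dependence on the sample is opaque. Its
  image under \<^const>\<open>sample_K\<close> is not: minimizing \<open>\<parallel>r - K b\<parallel>\<close> over the Krylov space
  amounts to projecting \<open>r\<close> onto the span of \<open>K r, \<dots>, K^m r\<close>. The residual and the test
  statistic depend on the estimator through this image only, which makes them measurable.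
\<close>

lemma pls_fit_eq_gram_schmidt_proj:
  "sample_K n xs (pls_estimator m n xs ys)
     = gram_schmidt_proj (\<lambda>j. (sample_K n xs ^^ Suc j) (sample_r n xs ys)) m (sample_r n xs ys)"
proof -
  define r where "r = sample_r n xs ys"
  define K where "K = sample_K n xs"
  define b where "b = pls_estimator m n xs ys"
  define B where "B = (\<lambda>j. (K ^^ j) r) ` {..<m}"
  define p where "p = gram_schmidt_proj (\<lambda>j. (K ^^ Suc j) r) m r"
  have kr: "krylov K r m = span B" by (simp add: krylov_def B_def)
  have img: "K ` span B = span ((\<lambda>j. (K ^^ Suc j) r) ` {..<m})"
    using linear_span_image[OF linear_sample_K[of n xs], of B, symmetric]
    by (simp add: K_def B_def image_image)
  have p: "p \<in> K ` span B" "\<And>q. q \<in> K ` span B \<Longrightarrow> (r - p) \<bullet> q = 0"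
    unfolding img p_def using gram_schmidt_proj_orthogonal by blast+
  have "is_arg_min (\<lambda>b. (norm (r - K b))\<^sup>2) (\<lambda>b. b \<in> span B) b"
    unfolding b_def pls_estimator_def arg_min_def kr[symmetric] r_def K_def
    using ex1_pls_minimizer by (rule someI_ex[OF ex1_implies_ex])
  then have b: "b \<in> span B" "\<And>c. c \<in> span B \<Longrightarrow> (norm (r - K b))\<^sup>2 \<le> (norm (r - K c))\<^sup>2"
    unfolding is_arg_min_linorder by auto
  have le: "(norm (r - K b))\<^sup>2 \<le> (norm (r - p))\<^sup>2" using p(1) b(2) by blast
  have "p - K b \<in> K ` span B"
    using p(1) b(1) unfolding img by (metis img imageI span_diff)
  then have "orthogonal (r - p) (p - K b)" using p(2) by (simp add: orthogonal_def)
  from norm_add_Pythagorean[OF this] le have "(norm (p - K b))\<^sup>2 \<le> 0" by simp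
  then show ?thesis by (simp add: p_def b_def r_def K_def)
qed

lemma borel_measurable_sample_r [measurable (raw)]:
  fixes Xs :: "nat \<Rightarrow> 's \<Rightarrow> 'h::{real_inner,second_countable_topology}"
  assumes [measurable]: "\<And>i. i \<in> {1..n} \<Longrightarrow> Xs i \<in> borel_measurable S"
    "\<And>i. i \<in> {1..n} \<Longrightarrow> Ys i \<in> borel_measurable S"
  shows "(\<lambda>s. sample_r n (\<lambda>i. Xs i s) (\<lambda>i. Ys i s)) \<in> borel_measurable S"
  unfolding sample_r_def by measurable

lemma borel_measurable_sample_K [measurable (raw)]:
  fixes Xs :: "nat \<Rightarrow> 's \<Rightarrow> 'h::{real_inner,second_countable_topology}"
  assumes [measurable]: "\<And>i. i \<in> {1..n} \<Longrightarrow> Xs i \<in> borel_measurable S" "f \<in> borel_measurable S"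
  shows "(\<lambda>s. sample_K n (\<lambda>i. Xs i s) (f s)) \<in> borel_measurable S"
  unfolding sample_K_def tensor_square_def by measurable

lemma borel_measurable_pls_fit:
  fixes Xs :: "nat \<Rightarrow> 's \<Rightarrow> 'h::{real_inner,second_countable_topology}"
  assumes Xs: "\<And>i. i \<in> {1..n} \<Longrightarrow> Xs i \<in> borel_measurable S"
    and Ys: "\<And>i. i \<in> {1..n} \<Longrightarrow> Ys i \<in> borel_measurable S"
    and m: "m \<in> measurable S (count_space UNIV)"
  shows "(\<lambda>s. sample_K n (\<lambda>i. Xs i s) (pls_estimator (m s) n (\<lambda>i. Xs i s) (\<lambda>i. Ys i s)))
           \<in> borel_measurable S"
proof (rule measurable_compose_countable[OF _ m])
  fix k :: nat
  have r: "(\<lambda>s. sample_r n (\<lambda>i. Xs i s) (\<lambda>i. Ys i s)) \<in> borel_measurable S"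
    using Xs Ys by (rule borel_measurable_sample_r)
  have "(\<lambda>s. (sample_K n (\<lambda>i. Xs i s) ^^ j) (sample_r n (\<lambda>i. Xs i s) (\<lambda>i. Ys i s)))
      \<in> borel_measurable S" for j
  proof (induction j)
    case (Suc j)
    then show ?case using borel_measurable_sample_K[OF Xs Suc] by simp
  qed (use r in simp)
  then show "(\<lambda>s. sample_K n (\<lambda>i. Xs i s) (pls_estimator k n (\<lambda>i. Xs i s) (\<lambda>i. Ys i s)))
           \<in> borel_measurable S"
    unfolding pls_fit_eq_gram_schmidt_proj
    using r by (intro borel_measurable_gram_schmidt_proj)
qed

section \<open>Second moments of sums of independent Hilbert-valued vectors\<close>

text \<open>
  The joint law of independent vectors is a product measure, so that by Fubini the expectation
  passes through both arguments of the inner product.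
\<close>

lemma (in prob_space) indep_var_inner:
  fixes A B :: "'a \<Rightarrow> 'h::{real_inner,banach,second_countable_topology}"
  assumes ind: "indep_var borel A borel B"
    and A: "integrable M A" and B: "integrable M B"
  shows "integrable M (\<lambda>x. A x \<bullet> B x)"
    and "expectation (\<lambda>x. A x \<bullet> B x) = expectation A \<bullet> expectation B"
proof -
  have [measurable]: "A \<in> borel_measurable M" "B \<in> borel_measurable M" using A B by auto
  have "indep_var borel (norm \<circ> A) borel (norm \<circ> B)"
    using ind by (rule indep_var_compose) auto
  then have "integrable M (\<lambda>x. norm (A x) * norm (B x))"
    using indep_var_integrable[of "norm \<circ> A" "norm \<circ> B"] A B by (simp add: comp_def)
  then show int: "integrable M (\<lambda>x. A x \<bullet> B x)"
    by (rule Bochner_Integration.integrable_bound)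
       (auto intro!: order_trans[OF Cauchy_Schwarz_ineq2])
  interpret dA: prob_space "distr M borel A" by (rule prob_space_distr) simp
  interpret dB: prob_space "distr M borel B" by (rule prob_space_distr) simp
  interpret AB: pair_prob_space "distr M borel A" "distr M borel B" ..
  have prod: "distr M borel A \<Otimes>\<^sub>M distr M borel B = distr M (borel \<Otimes>\<^sub>M borel) (\<lambda>x. (A x, B x))"
    using ind by (simp add: indep_var_distribution_eq)
  have intp: "integrable (distr M borel A \<Otimes>\<^sub>M distr M borel B) (\<lambda>(a, b). a \<bullet> b)"
    unfolding prod using int by (subst integrable_distr_eq) auto
  have "expectation (\<lambda>x. A x \<bullet> B x)
      = (\<integral>z. (case z of (a, b) \<Rightarrow> a \<bullet> b) \<partial>(distr M borel A \<Otimes>\<^sub>M distr M borel B))"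
    unfolding prod by (subst integral_distr) auto
  also have "\<dots> = (\<integral>a. (\<integral>b. a \<bullet> b \<partial>distr M borel B) \<partial>distr M borel A)"
    using AB.integral_fst'[OF intp] by simp
  also have "\<dots> = (\<integral>a. a \<bullet> expectation B \<partial>distr M borel A)"
    using B by (subst integral_inner_right) (auto simp: integrable_distr_eq integral_distr)
  also have "\<dots> = expectation A \<bullet> expectation B"
    using A by (subst integral_inner_left) (auto simp: integrable_distr_eq integral_distr)
  finally show "expectation (\<lambda>x. A x \<bullet> B x) = expectation A \<bullet> expectation B" .
qed

lemma square_norm_integrable_imp_integrable:
  fixes f :: "'a \<Rightarrow> 'h::{real_inner,banach,second_countable_topology}"
  assumes "prob_space M" "f \<in> borel_measurable M" "integrable M (\<lambda>x. (norm (f x))\<^sup>2)"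
  shows "integrable M f"
proof -
  interpret prob_space M by fact
  have "integrable M (\<lambda>x. norm (f x))"
    by (rule square_integrable_imp_integrable[OF _ assms(3)]) (use assms(2) in measurable)
  then show ?thesis using integrable_norm_iff[OF assms(2)] by simp
qed

text \<open>
  Expanding the square of the norm leaves the diagonal terms: the mixed ones have expectation zero
  by independence and centring.
\<close>

lemma (in prob_space) expectation_norm_square_sum_indep:
  fixes W :: "nat \<Rightarrow> 'a \<Rightarrow> 'h::{real_inner,banach,second_countable_topology}"
  assumes ind: "indep_vars (\<lambda>_. borel) W I" and I: "finite I"
    and int: "\<And>i. i \<in> I \<Longrightarrow> integrable M (\<lambda>x. (norm (W i x))\<^sup>2)"
    and mean: "\<And>i. i \<in> I \<Longrightarrow> expectation (W i) = 0"
  shows "integrable M (\<lambda>x. (norm (\<Sum>i\<in>I. W i x))\<^sup>2)"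
    and "expectation (\<lambda>x. (norm (\<Sum>i\<in>I. W i x))\<^sup>2) = (\<Sum>i\<in>I. expectation (\<lambda>x. (norm (W i x))\<^sup>2))"
proof -
  have [measurable]: "W i \<in> borel_measurable M" if "i \<in> I" for i
    using ind that unfolding indep_vars_def by blast
  have W: "integrable M (W i)" if "i \<in> I" for i
    using that by (intro square_norm_integrable_imp_integrable[OF prob_space_axioms _ int]) simp_all
  have pair: "integrable M (\<lambda>x. W i x \<bullet> W j x) \<and>
      expectation (\<lambda>x. W i x \<bullet> W j x) = (if i = j then expectation (\<lambda>x. (norm (W i x))\<^sup>2) else 0)"
    if ij: "i \<in> I" "j \<in> I" for i j
  proof (cases "i = j")
    case True
    then show ?thesis using int[OF ij(1)] by (simp add: power2_norm_eq_inner)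
  next
    case False
    have "indep_var (PiM {i} (\<lambda>_. borel)) (\<lambda>x. restrict (\<lambda>k. W k x) {i})
        (PiM {j} (\<lambda>_. borel)) (\<lambda>x. restrict (\<lambda>k. W k x) {j})"
      using ind False ij by (intro indep_var_restrict[where I = I]) auto
    then have "indep_var borel ((\<lambda>f. f i) \<circ> (\<lambda>x. restrict (\<lambda>k. W k x) {i}))
        borel ((\<lambda>f. f j) \<circ> (\<lambda>x. restrict (\<lambda>k. W k x) {j}))"
      by (rule indep_var_compose) (auto intro!: measurable_component_singleton)
    then have "indep_var borel (W i) borel (W j)" by (simp add: comp_def)
    from indep_var_inner[OF this W[OF ij(1)] W[OF ij(2)]] False mean[OF ij(1)]
    show ?thesis by simp
  qed
  have eq: "(norm (\<Sum>i\<in>I. W i x))\<^sup>2 = (\<Sum>i\<in>I. \<Sum>j\<in>I. W i x \<bullet> W j x)" for x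
    unfolding power2_norm_eq_inner inner_sum_left by (simp add: inner_sum_right)
  show "integrable M (\<lambda>x. (norm (\<Sum>i\<in>I. W i x))\<^sup>2)"
    unfolding eq using pair by (intro Bochner_Integration.integrable_sum) blast
  show "expectation (\<lambda>x. (norm (\<Sum>i\<in>I. W i x))\<^sup>2) = (\<Sum>i\<in>I. expectation (\<lambda>x. (norm (W i x))\<^sup>2))"
  proof -
    have "expectation (\<lambda>x. \<Sum>i\<in>I. \<Sum>j\<in>I. W i x \<bullet> W j x)
        = (\<Sum>i\<in>I. \<Sum>j\<in>I. expectation (\<lambda>x. W i x \<bullet> W j x))"
      using pair by (subst Bochner_Integration.integral_sum; intro sum.cong refl
          Bochner_Integration.integrable_sum Bochner_Integration.integral_sum) blast+
    also have "\<dots> = (\<Sum>i\<in>I. \<Sum>j\<in>I. if i = j then expectation (\<lambda>x. (norm (W i x))\<^sup>2) else 0)"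
      using pair by (intro sum.cong refl) blast
    also have "\<dots> = (\<Sum>i\<in>I. expectation (\<lambda>x. (norm (W i x))\<^sup>2))"
      using I by simp
    finally show ?thesis unfolding eq .
  qed
qed

section \<open>Powers of a characteristic function\<close>

text \<open>
  The analytic core of the central limit theorem, stated for a power of one characteristic function
  so that it applies to every row of a triangular array whose rows live on different probability
  spaces. The second-order expansion of the characteristic function has an error of smaller order
  than \<open>1/n\<close>, by dominated convergence, and taking \<open>n\<close>-th powers of numbers of modulus at most 1
  multiplies the error by at most \<open>n\<close>.
\<close>

lemma char_power_tendsto_gaussian:
  fixes f :: "'w \<Rightarrow> real"
  assumes M: "prob_space M" and f [measurable]: "f \<in> borel_measurable M"
    and int2: "integrable M (\<lambda>w. (f w)\<^sup>2)" and mean: "(\<integral>w. f w \<partial>M) = 0"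
  shows "(\<lambda>n. char (distr M borel f) (t / sqrt (real n)) ^ n)
           \<longlonglongrightarrow> of_real (exp (- (t\<^sup>2 * (\<integral>w. (f w)\<^sup>2 \<partial>M) / 2)))"
proof -
  interpret prob_space M by fact
  define v where "v = (\<integral>w. (f w)\<^sup>2 \<partial>M)"
  define g where "g n = (\<integral>w. min (6 * (f w)\<^sup>2) (\<bar>t / sqrt (real n)\<bar> * \<bar>f w\<bar> ^ 3) \<partial>M)" for n :: nat
  let ?\<psi> = "\<lambda>n. char (distr M borel f) (t / sqrt (real n))"
  let ?a = "\<lambda>n. 1 + (- (t\<^sup>2 * v / 2)) / real n"
  have intf: "integrable M f"
    using square_integrable_imp_integrable[OF f int2] .
  interpret D: real_distribution "distr M borel f" by (rule real_distribution_distr) simp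
  have v0: "0 \<le> v" by (simp add: v_def)
  have step: "norm (?\<psi> n - of_real (?a n)) \<le> ((t / sqrt (real n))\<^sup>2 / 6) * g n" for n
  proof -
    have "norm (?\<psi> n - (1 - of_real ((t / sqrt (real n))\<^sup>2 * v / 2))) \<le> ((t / sqrt (real n))\<^sup>2 / 6) * g n"
      unfolding g_def
      using char_approx3'[OF f intf int2 mean _ refl, of v "t / sqrt (real n)"] mean
      by (simp add: v_def)
    moreover have "(t / sqrt (real n))\<^sup>2 * v / 2 = (t\<^sup>2 * v / 2) / real n"
      by (simp add: power_divide)
    ultimately show ?thesis by simp
  qed
  \<comment> \<open>For such \<open>n\<close> the second-order polynomial, too, has modulus at most 1.\<close>
  have main: "norm (?\<psi> n ^ n - of_real (?a n ^ n)) \<le> t\<^sup>2 / 6 * g n"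
    if n: "n \<ge> max 1 (nat \<lceil>t\<^sup>2 * v / 2\<rceil>)" for n
  proof -
    have n1: "n \<ge> 1" and n2: "real n \<ge> t\<^sup>2 * v / 2" using n by (auto simp: nat_ceiling_le_eq)
    have "0 \<le> t\<^sup>2 * v / 2" using v0 by simp
    then have a: "\<bar>?a n\<bar> \<le> 1" using n1 n2 by (simp add: abs_le_iff divide_le_eq field_simps)
    have "norm (?\<psi> n ^ n - of_real (?a n) ^ n) \<le> real n * norm (?\<psi> n - of_real (?a n))"
      using a by (intro norm_power_diff D.cmod_char_le_1) (simp only: norm_of_real)
    also have "\<dots> \<le> real n * (((t / sqrt (real n))\<^sup>2 / 6) * g n)"
      using step by (intro mult_left_mono) auto
    also have "\<dots> = t\<^sup>2 / 6 * g n" using n1 by (simp add: power_divide)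
    finally show ?thesis by simp
  qed
  have "(\<lambda>n. t / sqrt (real n)) \<longlonglongrightarrow> 0"
    by (intro tendsto_divide_0[OF tendsto_const] filterlim_at_top_imp_at_infinity
        filterlim_compose[OF sqrt_at_top] filterlim_real_sequentially)
  then have "(\<lambda>n. \<bar>t / sqrt (real n)\<bar> * c) \<longlonglongrightarrow> 0" for c
    by (intro tendsto_mult_left_zero tendsto_rabs_zero)
  then have pt: "(\<lambda>n. min (6 * (f w)\<^sup>2) (\<bar>t / sqrt (real n)\<bar> * \<bar>f w\<bar> ^ 3)) \<longlonglongrightarrow> min (6 * (f w)\<^sup>2) 0" for w
    by (intro tendsto_min tendsto_const)
  have "g \<longlonglongrightarrow> (\<integral>w. 0 \<partial>M)"
    unfolding g_def
    by (rule integral_dominated_convergence[where w = "\<lambda>w. 6 * (f w)\<^sup>2"])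
       (use int2 pt in \<open>auto simp: min_absorb2\<close>)
  then have g0: "(\<lambda>n. t\<^sup>2 / 6 * g n) \<longlonglongrightarrow> 0"
    by (simp add: tendsto_mult_right_zero)
  have "(\<lambda>n. ?\<psi> n ^ n - of_real (?a n ^ n)) \<longlonglongrightarrow> 0"
    by (rule Lim_null_comparison[OF eventually_sequentiallyI[OF main] g0])
  moreover have "(\<lambda>n. complex_of_real (?a n ^ n)) \<longlonglongrightarrow> of_real (exp (- (t\<^sup>2 * v / 2)))"
    by (rule tendsto_of_real) (rule tendsto_exp_limit_sequentially)
  ultimately show ?thesis
    unfolding v_def[symmetric] by (rule Lim_transform[rotated])
qed

section \<open>Convergence in distribution from exponential moments\<close>

text \<open>
  The numbers \<open>E (exp (- k V))\<close> are the moments of the variable \<open>exp (- V)\<close> with values in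
  \<open>[0, 1]\<close>. By the Weierstrass theorem their convergence gives that of \<open>E (f (exp (- V)))\<close> for
  every continuous \<open>f\<close>, hence convergence in distribution.
\<close>

lemma exp_moments_imp_prob_greater_tendsto:
  fixes V :: "nat \<Rightarrow> 's \<Rightarrow> real" and U :: "'p \<Rightarrow> real"
  assumes S: "\<And>n. prob_space (S n)" and P: "prob_space P"
    and V [measurable]: "\<And>n. V n \<in> borel_measurable (S n)"
    and U [measurable]: "U \<in> borel_measurable P"
    and V0: "\<And>n s. 0 \<le> V n s" and U0: "AE p in P. 0 \<le> U p"
    and moments: "\<And>k::nat. (\<lambda>n. \<integral>s. exp (- (real k * V n s)) \<partial>S n) \<longlonglongrightarrow> (\<integral>p. exp (- (real k * U p)) \<partial>P)"
    and no_atom: "measure P {p \<in> space P. U p = z} = 0"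
  shows "(\<lambda>n. measure (S n) {s \<in> space (S n). V n s > z}) \<longlonglongrightarrow> measure P {p \<in> space P. U p > z}"
proof -
  interpret P: prob_space P by fact
  interpret S: prob_space "S n" for n by fact
  have poly: "(\<lambda>n. \<integral>s. q (exp (- V n s)) \<partial>S n) \<longlonglongrightarrow> (\<integral>p. q (exp (- U p)) \<partial>P)"
    if pq: "polynomial_function q" for q :: "real \<Rightarrow> real"
  proof -
    obtain a d where q: "q = (\<lambda>x. \<Sum>i\<le>d. a i * x ^ i)"
      using pq unfolding real_polynomial_function_eq[symmetric] real_polynomial_function_iff_sum
      by blast
    have pw: "exp (- x) ^ i = exp (- (real i * x))" for x :: real and i :: nat
      by (simp add: exp_of_nat_mult[symmetric])
    have iV: "integrable (S n) (\<lambda>s. exp (- (real i * V n s)))" for n i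
      by (intro S.integrable_const_bound[of _ 1] AE_I2) (simp_all add: V0)
    have iU: "integrable P (\<lambda>s. exp (- (real i * U s)))" for i
    proof (rule P.integrable_const_bound[of _ 1])
      show "AE p in P. norm (exp (- (real i * U p))) \<le> 1"
        using U0 by eventually_elim simp
    qed simp
    have "(\<integral>s. q (exp (- V n s)) \<partial>S n) = (\<Sum>i\<le>d. a i * (\<integral>s. exp (- (real i * V n s)) \<partial>S n))" for n
      unfolding q pw by (subst Bochner_Integration.integral_sum) (simp_all add: iV)
    moreover have "(\<integral>s. q (exp (- U s)) \<partial>P) = (\<Sum>i\<le>d. a i * (\<integral>s. exp (- (real i * U s)) \<partial>P))"
      unfolding q pw by (subst Bochner_Integration.integral_sum) (simp_all add: iU)
    ultimately show ?thesis
      by (simp only:) (intro tendsto_sum tendsto_mult tendsto_const moments)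
  qed
  have cont: "(\<lambda>n. \<integral>s. f (exp (- V n s)) \<partial>S n) \<longlonglongrightarrow> (\<integral>p. f (exp (- U p)) \<partial>P)"
    if f: "continuous_on UNIV f" for f :: "real \<Rightarrow> real"
  proof (rule LIMSEQ_I)
    fix e :: real assume e: "0 < e"
    have f01: "continuous_on {0..1} f" using f continuous_on_subset by blast
    then obtain q where q: "polynomial_function q" "\<And>x. x \<in> {0..1} \<Longrightarrow> norm (f x - q x) < e / 4"
      using Stone_Weierstrass_polynomial_function[of "{0..1::real}" f "e / 4"] e by auto
    have [measurable]: "f \<in> borel_measurable borel" "q \<in> borel_measurable borel"
      using f continuous_on_polymonial_function[OF q(1)] by (auto intro: borel_measurable_continuous_onI)
    have fq: "\<bar>f (exp (- x)) - q (exp (- x))\<bar> \<le> e / 4" if "0 \<le> x" for x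
      using q(2)[of "exp (- x)"] that by auto
    obtain B where B: "\<And>x. x \<in> {0..1} \<Longrightarrow> \<bar>f x\<bar> \<le> B"
      using compact_continuous_image[OF f01] compact_imp_bounded bounded_iff
      by (metis compact_Icc imageI real_norm_def)
    have B1: "\<bar>f (exp (- x))\<bar> \<le> B" if "0 \<le> x" for x using B[of "exp (- x)"] that by auto
    have B2: "\<bar>q (exp (- x))\<bar> \<le> B + e / 4" if "0 \<le> x" for x using B1[OF that] fq[OF that] by linarith
    have iV: "integrable (S n) (\<lambda>s. f (exp (- V n s)))" "integrable (S n) (\<lambda>s. q (exp (- V n s)))" for n
      by (rule S.integrable_const_bound[of _ B]; use B1[OF V0] in simp)
         (rule S.integrable_const_bound[of _ "B + e / 4"]; use B2[OF V0] in simp)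
    have iU: "integrable P (\<lambda>s. f (exp (- U s)))" "integrable P (\<lambda>s. q (exp (- U s)))"
    proof -
      have "AE p in P. norm (f (exp (- U p))) \<le> B" using U0 by eventually_elim (simp add: B1)
      then show "integrable P (\<lambda>s. f (exp (- U s)))" by (rule P.integrable_const_bound) simp
      have "AE p in P. norm (q (exp (- U p))) \<le> B + e / 4" using U0 by eventually_elim (simp add: B2)
      then show "integrable P (\<lambda>s. q (exp (- U s)))" by (rule P.integrable_const_bound) simp
    qed
    have dV: "\<bar>(\<integral>s. f (exp (- V n s)) \<partial>S n) - (\<integral>s. q (exp (- V n s)) \<partial>S n)\<bar> \<le> e / 4" for n
    proof -
      have "\<bar>\<integral>s. f (exp (- V n s)) - q (exp (- V n s)) \<partial>S n\<bar> \<le> (\<integral>s. e / 4 \<partial>S n)"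
        using iV fq[OF V0]
        by (intro integral_abs_bound[THEN order_trans] integral_mono integrable_abs
            Bochner_Integration.integrable_diff S.integrable_const)
      then show ?thesis using iV by (simp add: S.prob_space)
    qed
    have dU: "\<bar>(\<integral>s. f (exp (- U s)) \<partial>P) - (\<integral>s. q (exp (- U s)) \<partial>P)\<bar> \<le> e / 4"
    proof -
      have "\<bar>\<integral>s. f (exp (- U s)) - q (exp (- U s)) \<partial>P\<bar> \<le> (\<integral>s. e / 4 \<partial>P)"
        using iU
        by (intro integral_abs_bound[THEN order_trans] integral_mono_AE integrable_abs
            Bochner_Integration.integrable_diff P.integrable_const eventually_mono[OF U0] fq)
      then show ?thesis using iU by (simp add: P.prob_space)
    qed
    obtain n0 where n0: "\<And>n. n \<ge> n0 \<Longrightarrow>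
        norm ((\<integral>s. q (exp (- V n s)) \<partial>S n) - (\<integral>p. q (exp (- U p)) \<partial>P)) < e / 4"
      using LIMSEQ_D[OF poly[OF q(1)], of "e / 4"] e by auto
    have "norm ((\<integral>s. f (exp (- V n s)) \<partial>S n) - (\<integral>p. f (exp (- U p)) \<partial>P)) < e" if "n \<ge> n0" for n
      using n0[OF that] dV[of n] dU e unfolding real_norm_def by linarith
    then show "\<exists>no. \<forall>n\<ge>no. norm ((\<integral>s. f (exp (- V n s)) \<partial>S n) - (\<integral>p. f (exp (- U p)) \<partial>P)) < e"
      by blast
  qed
  let ?\<mu> = "\<lambda>n. distr (S n) borel (V n)" and ?\<nu> = "distr P borel U"
  have Dn: "real_distribution (?\<mu> n)" for n by (rule S.real_distribution_distr) simp
  have D: "real_distribution ?\<nu>" by (rule P.real_distribution_distr) simp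
  interpret \<nu>: real_distribution ?\<nu> by fact
  have "weak_conv_m ?\<mu> ?\<nu>"
  proof (rule integral_cts_step_conv_imp_weak_conv[OF Dn D])
    fix x y :: real assume xy: "x < y"
    \<comment> \<open>The step function vanishes above \<open>\<bar>y\<bar>\<close>, so truncating the logarithm near 0 does not change
        its values and makes it continuous in \<open>u = exp (- v)\<close>.\<close>
    define f where "f u = cts_step x y (- ln (max u (exp (- (\<bar>y\<bar> + 1)))))" for u
    have "continuous_on UNIV (cts_step x y)"
      using xy by (intro uniformly_continuous_imp_continuous cts_step_uniformly_continuous)
    then have cs: "continuous_on A (cts_step x y)" for A by (rule continuous_on_subset) simp
    have "continuous_on UNIV f"
      unfolding f_def
      by (intro continuous_on_compose2[OF cs[of UNIV]] continuous_intros)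
         (auto simp: max_def)
    from cont[OF this] have 1: "(\<lambda>n. \<integral>s. f (exp (- V n s)) \<partial>S n) \<longlonglongrightarrow> (\<integral>p. f (exp (- U p)) \<partial>P)" .
    have fe: "f (exp (- u)) = cts_step x y u" for u
      using xy by (cases "u \<le> \<bar>y\<bar> + 1") (auto simp: f_def max_def cts_step_def)
    have [measurable]: "cts_step x y \<in> borel_measurable borel"
      using cs by (rule borel_measurable_continuous_onI)
    show "(\<lambda>n. integral\<^sup>L (?\<mu> n) (cts_step x y)) \<longlonglongrightarrow> integral\<^sup>L ?\<nu> (cts_step x y)"
      using 1 unfolding fe by (simp add: integral_distr)
  qed
  moreover have "isCont (cdf ?\<nu>) z"
    using no_atom by (simp add: \<nu>.isCont_cdf measure_distr vimage_def Int_def conj_commute)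
  ultimately have "(\<lambda>n. cdf (?\<mu> n) z) \<longlonglongrightarrow> cdf ?\<nu> z"
    by (auto simp: weak_conv_m_def weak_conv_def)
  moreover have "measure (S n) {s \<in> space (S n). V n s > z} = 1 - cdf (?\<mu> n) z" for n
  proof -
    have "measure (S n) {s \<in> space (S n). V n s > z} = measure (S n) (space (S n) - {s \<in> space (S n). V n s \<le> z})"
      by (rule arg_cong[where f = "measure (S n)"]) auto
    also have "\<dots> = 1 - measure (S n) {s \<in> space (S n). V n s \<le> z}"
      by (rule S.prob_compl) simp
    finally show ?thesis by (simp add: cdf_def measure_distr vimage_def Int_def conj_commute)
  qed
  moreover have "measure P {s \<in> space P. U s > z} = 1 - cdf ?\<nu> z"
  proof -
    have "measure P {s \<in> space P. U s > z} = measure P (space P - {s \<in> space P. U s \<le> z})"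
      by (rule arg_cong[where f = "measure P"]) auto
    also have "\<dots> = 1 - measure P {s \<in> space P. U s \<le> z}"
      by (rule P.prob_compl) simp
    finally show ?thesis by (simp add: cdf_def measure_distr vimage_def Int_def conj_commute)
  qed
  ultimately show ?thesis by (auto intro!: tendsto_diff)
qed

section \<open>Random vectors with a diagonalized covariance operator\<close>

definition ortho_trunc :: "(nat \<Rightarrow> 'h::real_inner) \<Rightarrow> nat \<Rightarrow> 'h \<Rightarrow> 'h" where
  "ortho_trunc e N x = (\<Sum>j<N. (x \<bullet> e j) *\<^sub>R e j)"

text \<open>
  A centred square-integrable random vector whose covariance operator has the eigenvalues \<open>\<omega> j\<close>
  and eigenvectors \<open>e j\<close>. The covariance operator enters through its quadratic form. A vanishing
  eigenvalue is paired with the vector \<open>0\<close>, so that sums over the eigenvectors run over all indices.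
\<close>

locale spectral_vector = prob_space M
  for M :: "'w measure" and W :: "'w \<Rightarrow> 'h::{real_inner,banach,second_countable_topology}"
    and \<omega> :: "nat \<Rightarrow> real" and e :: "nat \<Rightarrow> 'h" +
  assumes W_measurable [measurable]: "W \<in> borel_measurable M"
    and W_square_integrable: "integrable M (\<lambda>w. (norm (W w))\<^sup>2)"
    and W_mean: "expectation W = 0"
    and \<omega>_nonneg: "0 \<le> \<omega> j"
    and e_orth: "e i \<bullet> e j = (if i = j \<and> \<omega> i \<noteq> 0 then 1 else 0)"
    and W_cov: "(\<lambda>j. \<omega> j * (e j \<bullet> u)\<^sup>2) sums expectation (\<lambda>w. (u \<bullet> W w)\<^sup>2)"
begin

lemma e_zero: "\<omega> j = 0 \<Longrightarrow> e j = 0"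
  using e_orth[of j j] by simp

lemma inner_ortho_trunc_e: "ortho_trunc e N x \<bullet> e i = (if i < N then x \<bullet> e i else 0)"
proof -
  have "ortho_trunc e N x \<bullet> e i = (\<Sum>j<N. if j = i then x \<bullet> e i else 0)"
    unfolding ortho_trunc_def inner_sum_left
    by (intro sum.cong) (auto simp: e_orth e_zero)
  then show ?thesis by simp
qed

lemma inner_ortho_trunc: "ortho_trunc e N x \<bullet> d = (\<Sum>j<N. (x \<bullet> e j) * (d \<bullet> e j))"
  by (simp add: ortho_trunc_def inner_sum_left inner_commute[of d])

lemma linear_ortho_trunc: "linear (ortho_trunc e N)"
  by (rule linearI)
     (simp_all add: ortho_trunc_def inner_add_left scaleR_left_distrib sum.distrib scaleR_sum_right)

lemma norm_ortho_trunc: "(norm (ortho_trunc e N x))\<^sup>2 = (\<Sum>j<N. (x \<bullet> e j)\<^sup>2)"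
  unfolding power2_norm_eq_inner inner_ortho_trunc[of N x "ortho_trunc e N x"]
  by (intro sum.cong) (auto simp: inner_ortho_trunc_e power2_eq_square)

lemma norm_diff_ortho_trunc: "(norm (x - ortho_trunc e N x))\<^sup>2 = (norm x)\<^sup>2 - (\<Sum>j<N. (x \<bullet> e j)\<^sup>2)"
proof -
  have "(norm (x - ortho_trunc e N x))\<^sup>2
      = (norm x)\<^sup>2 - 2 * (ortho_trunc e N x \<bullet> x) + (norm (ortho_trunc e N x))\<^sup>2"
    by (simp add: power2_norm_eq_inner inner_diff_left inner_diff_right inner_commute)
  also have "ortho_trunc e N x \<bullet> x = (\<Sum>j<N. (x \<bullet> e j)\<^sup>2)"
    by (simp add: inner_ortho_trunc power2_eq_square)
  finally show ?thesis by (simp add: norm_ortho_trunc)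
qed

lemma bessel: "(\<Sum>j<N. (x \<bullet> e j)\<^sup>2) \<le> (norm x)\<^sup>2"
  using norm_diff_ortho_trunc[of x N] zero_le_power2[of "norm (x - ortho_trunc e N x)"] by linarith

lemma norm_diff_ortho_trunc_le: "norm (x - ortho_trunc e N x) \<le> norm x"
proof -
  have "(norm (x - ortho_trunc e N x))\<^sup>2 \<le> (norm x)\<^sup>2"
    unfolding norm_diff_ortho_trunc by (simp add: sum_nonneg)
  then show ?thesis by (simp add: power2_le_iff_abs_le)
qed

lemma summable_bessel: "summable (\<lambda>j. (x \<bullet> e j)\<^sup>2)"
  using bessel by (intro summableI_nonneg_bounded) auto

lemma measurable_ortho_trunc [measurable]: "ortho_trunc e N \<in> borel_measurable borel"
  unfolding ortho_trunc_def[abs_def] by measurable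

lemma convergent_ortho_trunc: "convergent (\<lambda>N. ortho_trunc e N x)"
proof (rule Cauchy_convergent, rule metric_CauchyI)
  fix c :: real assume c: "0 < c"
  define s where "s N = (\<Sum>j<N. (x \<bullet> e j)\<^sup>2)" for N
  have "convergent s"
    using summable_bessel[of x] by (simp add: s_def[abs_def] summable_iff_convergent)
  then obtain n0 where n0: "\<And>m n. m \<ge> n0 \<Longrightarrow> n \<ge> n0 \<Longrightarrow> dist (s m) (s n) < c\<^sup>2"
    using c convergent_Cauchy metric_CauchyD[of s "c\<^sup>2"] by (metis zero_less_power)
  have diff: "(norm (ortho_trunc e m x - ortho_trunc e n x))\<^sup>2 = s m - s n" if "n \<le> m" for m n
  proof -
    have "ortho_trunc e n (ortho_trunc e m x) = ortho_trunc e n x"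
      unfolding ortho_trunc_def[of e n] using that
      by (intro sum.cong) (auto simp: inner_ortho_trunc_e)
    then have "(norm (ortho_trunc e m x - ortho_trunc e n x))\<^sup>2
       = s m - (\<Sum>j<n. (ortho_trunc e m x \<bullet> e j)\<^sup>2)"
      using norm_diff_ortho_trunc[of "ortho_trunc e m x" n] by (simp add: norm_ortho_trunc s_def)
    also have "(\<Sum>j<n. (ortho_trunc e m x \<bullet> e j)\<^sup>2) = s n"
      unfolding s_def using that by (intro sum.cong) (auto simp: inner_ortho_trunc_e)
    finally show ?thesis .
  qed
  have *: "dist (ortho_trunc e m x) (ortho_trunc e n x) < c" if "n \<ge> n0" "n \<le> m" for m n
  proof -
    have "(norm (ortho_trunc e m x - ortho_trunc e n x))\<^sup>2 < c\<^sup>2"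
      using n0[of m n] that diff[OF that(2)] by (auto simp: dist_real_def)
    then show ?thesis using c by (simp add: dist_norm power2_less_imp_less)
  qed
  show "\<exists>M. \<forall>m\<ge>M. \<forall>n\<ge>M. dist (ortho_trunc e m x) (ortho_trunc e n x) < c"
  proof (intro exI allI impI)
    fix m n assume "n0 \<le> m" "n0 \<le> n"
    then show "dist (ortho_trunc e m x) (ortho_trunc e n x) < c"
      using *[of n m] *[of m n] by (cases "n \<le> m") (auto simp: dist_commute)
  qed
qed

text \<open>
  For the variance of \<open>W\<close> in the directions \<open>\<xi>\<close> that arise from writing exponentials of squared norms
  as mixtures of characters.
\<close>

lemma expectation_inner_trunc:
  "expectation (\<lambda>w. ((\<Sum>j<N. u j *\<^sub>R e j) \<bullet> W w)\<^sup>2) = (\<Sum>j<N. \<omega> j * (u j)\<^sup>2)"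
proof -
  define y where "y = (\<Sum>j<N. u j *\<^sub>R e j)"
  have y: "\<omega> j * (e j \<bullet> y)\<^sup>2 = (if j < N then \<omega> j * (u j)\<^sup>2 else 0)" for j
  proof -
    have "e j \<bullet> y = (\<Sum>i<N. if i = j then (if \<omega> j = 0 then 0 else u j) else 0)"
      unfolding y_def inner_sum_right by (intro sum.cong) (auto simp: e_orth)
    then show ?thesis by simp
  qed
  have "(\<lambda>j. \<omega> j * (e j \<bullet> y)\<^sup>2) sums (\<Sum>j\<in>{..<N}. \<omega> j * (e j \<bullet> y)\<^sup>2)"
    by (rule sums_finite) (auto simp: y)
  then have "expectation (\<lambda>w. (y \<bullet> W w)\<^sup>2) = (\<Sum>j\<in>{..<N}. \<omega> j * (e j \<bullet> y)\<^sup>2)"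
    using W_cov[of y] sums_unique2 by blast
  also have "\<dots> = (\<Sum>j<N. \<omega> j * (u j)\<^sup>2)" by (intro sum.cong) (auto simp: y)
  finally show ?thesis by (simp add: y_def)
qed

lemma square_integrable_inner: "integrable M (\<lambda>w. (u \<bullet> W w)\<^sup>2)"
proof (rule Bochner_Integration.integrable_bound)
  show "integrable M (\<lambda>w. (norm u)\<^sup>2 * (norm (W w))\<^sup>2)" using W_square_integrable by simp
  show "AE w in M. norm ((u \<bullet> W w)\<^sup>2) \<le> norm ((norm u)\<^sup>2 * (norm (W w))\<^sup>2)"
    using Cauchy_Schwarz_ineq[of u] by (auto simp: power2_norm_eq_inner)
qed simp

lemma summable_\<omega>: "summable \<omega>"
proof (rule summableI_nonneg_bounded)
  fix N
  have one: "expectation (\<lambda>w. (e j \<bullet> W w)\<^sup>2) = \<omega> j" for j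
  proof -
    have "(\<lambda>i. \<omega> i * (e i \<bullet> e j)\<^sup>2) sums (\<Sum>i\<in>{j}. \<omega> i * (e i \<bullet> e j)\<^sup>2)"
      by (rule sums_finite) (auto simp: e_orth)
    then show ?thesis using W_cov[of "e j"] sums_unique2 by (fastforce simp: e_orth)
  qed
  have "(\<Sum>j<N. \<omega> j) = expectation (\<lambda>w. \<Sum>j<N. (e j \<bullet> W w)\<^sup>2)"
    using square_integrable_inner by (simp add: one Bochner_Integration.integral_sum)
  also have "\<dots> \<le> expectation (\<lambda>w. (norm (W w))\<^sup>2)"
  proof (intro integral_mono Bochner_Integration.integrable_sum square_integrable_inner W_square_integrable)
    show "(\<Sum>j<N. (e j \<bullet> W w)\<^sup>2) \<le> (norm (W w))\<^sup>2" for w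
      using bessel[of "W w" N] by (simp only: inner_commute[of "W w"])
  qed
  finally show "(\<Sum>j<N. \<omega> j) \<le> expectation (\<lambda>w. (norm (W w))\<^sup>2)" .
qed (rule \<omega>_nonneg)

text \<open>
  Almost surely \<open>W\<close> lies in the closed span of the eigenvectors. The remainder
  \<open>R = W - lim\<^sub>N (ortho_trunc e N W)\<close> has variance zero in every direction \<open>d\<close>, because the
  variance of \<open>(W - ortho_trunc e N W) \<bullet> d\<close> is a tail of the convergent series
  \<open>\<Sum>j. \<omega> j * (e j \<bullet> d)\<^sup>2\<close>. So \<open>R\<close> is almost surely orthogonal to a countable dense set.
\<close>

lemma ortho_trunc_tendsto: "AE w in M. (\<lambda>N. ortho_trunc e N (W w)) \<longlonglongrightarrow> W w"
proof -
  define R where "R w = W w - lim (\<lambda>N. ortho_trunc e N (W w))" for w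
  have lim: "(\<lambda>N. W w - ortho_trunc e N (W w)) \<longlonglongrightarrow> R w" for w
    unfolding R_def using convergent_ortho_trunc[of "W w"]
    by (intro tendsto_diff tendsto_const) (simp add: convergent_LIMSEQ_iff)
  have [measurable]: "R \<in> borel_measurable M"
    by (rule borel_measurable_LIMSEQ_metric[OF _ lim]) measurable
  have R0: "AE w in M. R w \<bullet> d = 0" for d
  proof -
    have adj: "(W w - ortho_trunc e N (W w)) \<bullet> d = (d - ortho_trunc e N d) \<bullet> W w" for N w
      by (simp add: inner_diff_left inner_diff_right inner_ortho_trunc inner_commute[of d "W w"] mult.commute)
    have ed: "e j \<bullet> (d - ortho_trunc e N d) = (if j < N then 0 else e j \<bullet> d)" for j N
      using inner_ortho_trunc_e[of N d j] by (simp add: inner_diff_right inner_commute)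
    have sm: "summable (\<lambda>j. \<omega> j * (e j \<bullet> d)\<^sup>2)" using W_cov sums_summable by blast
    have "expectation (\<lambda>w. ((W w - ortho_trunc e N (W w)) \<bullet> d)\<^sup>2)
       = (\<Sum>j. \<omega> (j + N) * (e (j + N) \<bullet> d)\<^sup>2)" for N
    proof -
      have "expectation (\<lambda>w. ((W w - ortho_trunc e N (W w)) \<bullet> d)\<^sup>2)
        = (\<Sum>j. \<omega> j * (e j \<bullet> (d - ortho_trunc e N d))\<^sup>2)"
        unfolding adj using W_cov sums_unique by blast
      also have "\<dots> = (\<Sum>j. \<omega> (j + N) * (e (j + N) \<bullet> (d - ortho_trunc e N d))\<^sup>2)
          + (\<Sum>j<N. \<omega> j * (e j \<bullet> (d - ortho_trunc e N d))\<^sup>2)"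
        by (rule suminf_split_initial_segment) (use W_cov sums_summable in blast)
      finally show ?thesis by (simp add: ed)
    qed
    moreover have "(\<lambda>N. \<Sum>j. \<omega> (j + N) * (e (j + N) \<bullet> d)\<^sup>2) \<longlonglongrightarrow> 0"
      using suminf_exist_split2[OF sm] .
    ultimately have "(\<lambda>N. expectation (\<lambda>w. ((W w - ortho_trunc e N (W w)) \<bullet> d)\<^sup>2)) \<longlonglongrightarrow> 0" by simp
    moreover have "(\<lambda>N. expectation (\<lambda>w. ((W w - ortho_trunc e N (W w)) \<bullet> d)\<^sup>2))
        \<longlonglongrightarrow> expectation (\<lambda>w. (R w \<bullet> d)\<^sup>2)"
    proof (rule integral_dominated_convergence[where w = "\<lambda>w. (norm (W w))\<^sup>2 * (norm d)\<^sup>2"])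
      show "AE w in M. (\<lambda>N. ((W w - ortho_trunc e N (W w)) \<bullet> d)\<^sup>2) \<longlonglongrightarrow> (R w \<bullet> d)\<^sup>2"
        using lim by (auto intro!: tendsto_power tendsto_inner)
      show "AE w in M. norm (((W w - ortho_trunc e N (W w)) \<bullet> d)\<^sup>2) \<le> (norm (W w))\<^sup>2 * (norm d)\<^sup>2" for N
      proof (rule AE_I2)
        fix w
        have "\<bar>(W w - ortho_trunc e N (W w)) \<bullet> d\<bar> \<le> norm (W w - ortho_trunc e N (W w)) * norm d"
          by (rule Cauchy_Schwarz_ineq2)
        also have "\<dots> \<le> norm (W w) * norm d"
          by (intro mult_right_mono norm_diff_ortho_trunc_le) simp
        finally show "norm (((W w - ortho_trunc e N (W w)) \<bullet> d)\<^sup>2) \<le> (norm (W w))\<^sup>2 * (norm d)\<^sup>2"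
          by (simp add: abs_le_square_iff[symmetric] power_mult_distrib[symmetric])
      qed
    qed (use W_square_integrable in auto)
    ultimately have 0: "expectation (\<lambda>w. (R w \<bullet> d)\<^sup>2) = 0" using LIMSEQ_unique by blast
    have "integrable M (\<lambda>w. (R w \<bullet> d)\<^sup>2)"
    proof (rule Bochner_Integration.integrable_bound)
      show "integrable M (\<lambda>w. (norm (W w))\<^sup>2 * (norm d)\<^sup>2)" using W_square_integrable by simp
      have "norm (R w) \<le> norm (W w)" for w
        using norm_diff_ortho_trunc_le by (intro LIMSEQ_le_const2[OF tendsto_norm[OF lim]]) blast
      then have "\<bar>R w \<bullet> d\<bar> \<le> norm (W w) * norm d" for w
        by (meson Cauchy_Schwarz_ineq2 mult_right_mono norm_ge_zero order_trans)
      then show "AE w in M. norm ((R w \<bullet> d)\<^sup>2) \<le> norm ((norm (W w))\<^sup>2 * (norm d)\<^sup>2)"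
        by (auto simp: abs_le_square_iff[symmetric] power_mult_distrib[symmetric])
    qed simp
    with 0 show ?thesis by (subst (asm) integral_nonneg_eq_0_iff_AE) auto
  qed
  obtain D :: "'h set" where D: "countable D" "\<And>X. open X \<Longrightarrow> X \<noteq> {} \<Longrightarrow> \<exists>d\<in>D. d \<in> X"
    by (rule countable_dense_setE) blast
  have "AE w in M. \<forall>d\<in>D. R w \<bullet> d = 0" using R0 D(1) by (simp add: AE_ball_countable)
  then show ?thesis
  proof eventually_elim
    case (elim w)
    have "open {d. R w \<bullet> d \<noteq> 0}" by (intro open_Collect_neq continuous_intros)
    then have "{d. R w \<bullet> d \<noteq> 0} = {}" using D(2) elim by blast
    then have "R w = 0" by (metis (mono_tags, lifting) empty_iff inner_eq_zero_iff mem_Collect_eq)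
    then show ?case using tendsto_diff[OF tendsto_const lim[of w], of "W w"] by simp
  qed
qed

text \<open>
  Replacing \<open>W\<close> by finitely many coordinates costs little in mean square, and
  the same bound will hold for normalized sums of any number of copies of \<open>W\<close>.
\<close>

lemma tail_tendsto_0: "(\<lambda>N. expectation (\<lambda>w. (norm (W w - ortho_trunc e N (W w)))\<^sup>2)) \<longlonglongrightarrow> 0"
proof -
  have "(\<lambda>N. expectation (\<lambda>w. (norm (W w - ortho_trunc e N (W w)))\<^sup>2)) \<longlonglongrightarrow> expectation (\<lambda>w. 0)"
  proof (rule integral_dominated_convergence[where w = "\<lambda>w. (norm (W w))\<^sup>2"])
    show "AE w in M. (\<lambda>N. (norm (W w - ortho_trunc e N (W w)))\<^sup>2) \<longlonglongrightarrow> 0"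
      using ortho_trunc_tendsto
    proof eventually_elim
      case (elim w)
      have "(\<lambda>N. (norm (W w - ortho_trunc e N (W w)))\<^sup>2) \<longlonglongrightarrow> (norm (W w - W w))\<^sup>2"
        using elim by (intro tendsto_intros)
      then show ?case by simp
    qed
  qed (use W_square_integrable norm_diff_ortho_trunc_le in auto)
  then show ?thesis by simp
qed

end

section \<open>Normalized sums of i.i.d. copies\<close>

lemma iid_copies_measurable:
  assumes "iid_copies S n Z M W" "i \<in> {1..n}"
  shows "Z i \<in> borel_measurable S"
proof -
  interpret prob_space S using assms(1) by (simp add: iid_copies_def)
  show ?thesis using assms unfolding iid_copies_def indep_vars_def by blast
qed

lemma iid_copies_compose:
  assumes iid: "iid_copies S n Z M W" and W: "W \<in> borel_measurable M"
    and f: "f \<in> borel_measurable borel"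
  shows "iid_copies S n (\<lambda>i s. f (Z i s)) M (\<lambda>w. f (W w))"
proof -
  interpret prob_space S using iid by (simp add: iid_copies_def)
  have "distr S borel (\<lambda>s. f (Z i s)) = distr M borel (\<lambda>w. f (W w))" if i: "i \<in> {1..n}" for i
  proof -
    have "distr S borel (\<lambda>s. f (Z i s)) = distr (distr S borel (Z i)) borel f"
      using f iid_copies_measurable[OF iid i] by (simp add: distr_distr comp_def)
    also have "\<dots> = distr (distr M borel W) borel f" using iid i by (simp add: iid_copies_def)
    also have "\<dots> = distr M borel (\<lambda>w. f (W w))" using f W by (simp add: distr_distr comp_def)
    finally show ?thesis .
  qed
  moreover have "indep_vars (\<lambda>_. borel) (\<lambda>i s. f (Z i s)) {1..n}"
  proof (rule indep_vars_compose2[where X = Z and M' = "\<lambda>_. borel" and Y = "\<lambda>_. f"])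
    show "indep_vars (\<lambda>_. borel) Z {1..n}" using iid by (simp add: iid_copies_def)
  qed (rule f)
  ultimately show ?thesis using prob_space_axioms by (simp add: iid_copies_def)
qed

lemma iid_copies_integral:
  fixes f :: "'b::topological_space \<Rightarrow> 'c::{banach,second_countable_topology}"
  assumes iid: "iid_copies S n Z M W" and W: "W \<in> borel_measurable M" and i: "i \<in> {1..n}"
    and f: "f \<in> borel_measurable borel"
  shows "integrable S (\<lambda>s. f (Z i s)) \<longleftrightarrow> integrable M (\<lambda>w. f (W w))"
    and "(\<integral>s. f (Z i s) \<partial>S) = (\<integral>w. f (W w) \<partial>M)"
proof -
  have d: "distr S borel (Z i) = distr M borel W" using iid i by (simp add: iid_copies_def)
  note Zi = iid_copies_measurable[OF iid i]
  show "integrable S (\<lambda>s. f (Z i s)) \<longleftrightarrow> integrable M (\<lambda>w. f (W w))"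
    using integrable_distr_eq[OF Zi f] integrable_distr_eq[OF W f] d by simp
  show "(\<integral>s. f (Z i s) \<partial>S) = (\<integral>w. f (W w) \<partial>M)"
    using integral_distr[OF Zi f] integral_distr[OF W f] d by simp
qed

definition normalized_sum :: "nat \<Rightarrow> (nat \<Rightarrow> 'h::real_vector) \<Rightarrow> 'h" where
  "normalized_sum n x = (1 / sqrt (real n)) *\<^sub>R (\<Sum>i=1..n. x i)"

lemma borel_measurable_normalized_sum:
  fixes Z :: "nat \<Rightarrow> 's \<Rightarrow> 'h::{real_inner,second_countable_topology}"
  assumes "iid_copies S n Z M W"
  shows "(\<lambda>s. normalized_sum n (\<lambda>i. Z i s)) \<in> borel_measurable S"
  unfolding normalized_sum_def
  by (intro borel_measurable_scaleR borel_measurable_const borel_measurable_sum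
      iid_copies_measurable[OF assms])

text \<open>
  The scaling by \<open>1 / sqrt n\<close> exactly compensates the number of summands. The identity serves as law
  of large numbers, as stochastic boundedness and, later, as control of truncation errors.
\<close>

lemma normalized_sum_second_moment:
  fixes W :: "'w \<Rightarrow> 'h::{real_inner,banach,second_countable_topology}"
  assumes iid: "iid_copies S n Z M W" and n: "1 \<le> n" and W: "W \<in> borel_measurable M"
    and int: "integrable M (\<lambda>w. (norm (W w))\<^sup>2)" and mean: "(\<integral>w. W w \<partial>M) = 0"
  shows "integrable S (\<lambda>s. (norm (normalized_sum n (\<lambda>i. Z i s)))\<^sup>2)"
    and "(\<integral>s. (norm (normalized_sum n (\<lambda>i. Z i s)))\<^sup>2 \<partial>S) = (\<integral>w. (norm (W w))\<^sup>2 \<partial>M)"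
proof -
  interpret prob_space S using iid by (simp add: iid_copies_def)
  have nm: "(\<lambda>x::'h. (norm x)\<^sup>2) \<in> borel_measurable borel" by measurable
  have ind: "indep_vars (\<lambda>_. borel) Z {1..n}" using iid by (simp add: iid_copies_def)
  have i1: "integrable S (\<lambda>s. (norm (Z i s))\<^sup>2)" if "i \<in> {1..n}" for i
    using iid_copies_integral(1)[OF iid W that nm] int by simp
  have i2: "expectation (\<lambda>s. (norm (Z i s))\<^sup>2) = (\<integral>w. (norm (W w))\<^sup>2 \<partial>M)" if "i \<in> {1..n}" for i
    using iid_copies_integral(2)[OF iid W that nm] .
  have i3: "expectation (Z i) = 0" if "i \<in> {1..n}" for i
    using iid_copies_integral(2)[OF iid W that, of "\<lambda>x. x"] mean by simp
  have eq: "(norm (normalized_sum n (\<lambda>i. Z i s)))\<^sup>2 = (1 / real n) * (norm (\<Sum>i=1..n. Z i s))\<^sup>2" for s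
    by (simp add: normalized_sum_def power_mult_distrib power_divide)
  note sum = expectation_norm_square_sum_indep[OF ind finite_atLeastAtMost i1 i3]
  show "integrable S (\<lambda>s. (norm (normalized_sum n (\<lambda>i. Z i s)))\<^sup>2)"
    unfolding eq using sum(1) by simp
  show "(\<integral>s. (norm (normalized_sum n (\<lambda>i. Z i s)))\<^sup>2 \<partial>S) = (\<integral>w. (norm (W w))\<^sup>2 \<partial>M)"
    unfolding eq using sum(2) n by (simp add: i2)
qed

lemma normalized_sum_char:
  fixes W :: "'w \<Rightarrow> real"
  assumes iid: "iid_copies S n Z M W"
  shows "(\<integral>s. iexp (normalized_sum n (\<lambda>i. Z i s)) \<partial>S)
           = char (distr M borel W) (1 / sqrt (real n)) ^ n"
proof -
  interpret prob_space S using iid by (simp add: iid_copies_def)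
  note [measurable] = iid_copies_measurable[OF iid]
  have ind: "indep_vars (\<lambda>_. borel) Z {1..n}" using iid by (simp add: iid_copies_def)
  have "(\<integral>s. iexp (normalized_sum n (\<lambda>i. Z i s)) \<partial>S)
      = char (distr S borel (\<lambda>s. \<Sum>i\<in>{1..n}. Z i s)) (1 / sqrt (real n))"
    unfolding char_def by (subst integral_distr) (auto simp: normalized_sum_def)
  also have "\<dots> = (\<Prod>i\<in>{1..n}. char (distr S borel (Z i)) (1 / sqrt (real n)))"
    using ind by (rule char_distr_sum)
  also have "\<dots> = (\<Prod>i\<in>{1..n}. char (distr M borel W) (1 / sqrt (real n)))"
    using iid by (intro prod.cong refl) (simp add: iid_copies_def)
  finally show ?thesis by simp
qed

section \<open>Gaussian mixtures of characters\<close>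

locale gaussian_sequence = prob_space P for P :: "'p measure" +
  fixes Z :: "nat \<Rightarrow> 'p \<Rightarrow> real"
  assumes Z_indep: "indep_vars (\<lambda>_. borel) Z UNIV"
    and Z_normal: "distributed P lborel (Z j) std_normal_density"
begin

lemma Z_measurable [measurable]: "Z j \<in> borel_measurable P"
  using distributed_measurable[OF Z_normal[of j]] by simp

lemma distr_Z: "distr P borel (Z j) = std_normal_distribution"
proof -
  have "distr P borel (Z j) = distr P lborel (Z j)" by (rule distr_cong) auto
  then show ?thesis using distributed_distr_eq_density[OF Z_normal[of j]] by simp
qed

lemma expectation_iexp_sum:
  "expectation (\<lambda>p. iexp (\<Sum>j<N. y j * Z j p)) = of_real (exp (- (\<Sum>j<N. (y j)\<^sup>2) / 2))"
proof -
  have ind: "indep_vars (\<lambda>_. borel) (\<lambda>j p. y j * Z j p) {..<N}"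
    by (rule indep_vars_compose2[OF indep_vars_subset[OF Z_indep]]) auto
  have one: "char (distr P borel (\<lambda>p. y j * Z j p)) 1 = of_real (exp (- ((y j)\<^sup>2 / 2)))" for j
  proof -
    have "char (distr P borel (\<lambda>p. y j * Z j p)) 1 = char (distr P borel (Z j)) (y j)"
      unfolding char_def by (simp add: integral_distr)
    then show ?thesis by (simp add: distr_Z char_std_normal_distribution)
  qed
  have "expectation (\<lambda>p. iexp (\<Sum>j<N. y j * Z j p))
      = char (distr P borel (\<lambda>p. \<Sum>j\<in>{..<N}. y j * Z j p)) 1"
    unfolding char_def by (subst integral_distr) auto
  also have "\<dots> = (\<Prod>j\<in>{..<N}. char (distr P borel (\<lambda>p. y j * Z j p)) 1)"
    using ind by (rule char_distr_sum)
  also have "\<dots> = of_real (\<Prod>j<N. exp (- ((y j)\<^sup>2 / 2)))"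
    by (simp only: one of_real_prod)
  also have "(\<Prod>j<N. exp (- ((y j)\<^sup>2 / 2))) = exp (\<Sum>j<N. - ((y j)\<^sup>2 / 2))"
    by (simp add: exp_sum)
  also have "(\<Sum>j<N. - ((y j)\<^sup>2 / 2)) = - (\<Sum>j<N. (y j)\<^sup>2) / 2"
    by (simp add: sum_negf sum_divide_distrib)
  finally show ?thesis .
qed

text \<open>
  The function \<open>exp (- k |y|\<^sup>2)\<close> of \<open>y = g + h\<close> is the Gaussian mixture of the characters
  \<open>iexp (\<xi> \<bullet> y)\<close> with \<open>\<xi> = sqrt (2 k) Z\<close>. Integrating over \<open>g\<close> first, by Fubini, expresses a Laplace
  transform of a squared norm by characteristic functions of the linear functionals \<open>\<xi> \<bullet> g\<close>,
  for which the one-dimensional theory suffices.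
\<close>

lemma expectation_exp_square_mixing:
  fixes g :: "nat \<Rightarrow> 's \<Rightarrow> real" and k :: real
  assumes Q: "prob_space Q" and g [measurable]: "\<And>j. g j \<in> borel_measurable Q" and k: "0 \<le> k"
  shows "of_real (\<integral>s. exp (- (k * (\<Sum>j<N. (g j s + h j)\<^sup>2))) \<partial>Q)
    = expectation (\<lambda>p. iexp (\<Sum>j<N. sqrt (2 * k) * h j * Z j p)
        * (\<integral>s. iexp (\<Sum>j<N. (sqrt (2 * k) * Z j p) * g j s) \<partial>Q))"
proof -
  interpret Q: prob_space Q by fact
  interpret QP: pair_prob_space Q P ..
  define r where "r = sqrt (2 * k)"
  define F :: "'s \<times> 'p \<Rightarrow> complex"
    where "F = (\<lambda>(s, p). iexp (\<Sum>j<N. (r * (g j s + h j)) * Z j p))"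
  have [measurable]: "F \<in> borel_measurable (Q \<Otimes>\<^sub>M P)" unfolding F_def by measurable
  have intF: "integrable (Q \<Otimes>\<^sub>M P) F"
    by (rule QP.P.integrable_const_bound[of _ 1]) (auto simp: F_def)
  have r2: "(r * a)\<^sup>2 = 2 * (k * a\<^sup>2)" for a using k by (simp add: r_def power_mult_distrib)
  have inner: "(\<integral>p. F (s, p) \<partial>P) = of_real (exp (- (k * (\<Sum>j<N. (g j s + h j)\<^sup>2))))" for s
    unfolding F_def prod.case expectation_iexp_sum
    by (simp add: r2 sum_distrib_left[symmetric])
  have "of_real (\<integral>s. exp (- (k * (\<Sum>j<N. (g j s + h j)\<^sup>2))) \<partial>Q)
      = (\<integral>s. (\<integral>p. F (s, p) \<partial>P) \<partial>Q)"
    unfolding inner by simp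
  also have "\<dots> = (\<integral>p. (\<integral>s. F (s, p) \<partial>Q) \<partial>P)"
    using QP.Fubini_integral[of "\<lambda>s p. F (s, p)"] intF by simp
  also have "\<dots> = expectation (\<lambda>p. iexp (\<Sum>j<N. r * h j * Z j p)
        * (\<integral>s. iexp (\<Sum>j<N. (r * Z j p) * g j s) \<partial>Q))"
  proof (rule Bochner_Integration.integral_cong[OF refl])
    fix p
    have "F (s, p) = iexp (\<Sum>j<N. r * h j * Z j p) * iexp (\<Sum>j<N. (r * Z j p) * g j s)" for s
    proof -
      have "(\<Sum>j<N. (r * (g j s + h j)) * Z j p)
          = (\<Sum>j<N. r * h j * Z j p) + (\<Sum>j<N. (r * Z j p) * g j s)"
        by (simp add: sum.distrib[symmetric] algebra_simps)
      then show ?thesis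
        by (simp only: F_def prod.case of_real_add distrib_left exp_add)
    qed
    then show "(\<integral>s. F (s, p) \<partial>Q) = iexp (\<Sum>j<N. r * h j * Z j p)
        * (\<integral>s. iexp (\<Sum>j<N. (r * Z j p) * g j s) \<partial>Q)" by simp
  qed
  finally show ?thesis by (simp only: r_def)
qed

end

section \<open>Central limit theorem for shifted squared norms\<close>

lemma tendsto_of_uniformly_close:
  fixes a :: "nat \<Rightarrow> real"
  assumes approx: "\<And>N. eventually (\<lambda>n. \<bar>a n - b N n\<bar> \<le> \<tau> N) sequentially"
    and \<tau>: "\<tau> \<longlonglongrightarrow> 0" and b: "\<And>N. b N \<longlonglongrightarrow> c N" and c: "c \<longlonglongrightarrow> d"
  shows "a \<longlonglongrightarrow> d"
proof (rule tendstoI)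
  fix \<epsilon> :: real assume \<epsilon>: "0 < \<epsilon>"
  have "eventually (\<lambda>N. dist (\<tau> N) 0 < \<epsilon> / 3 \<and> dist (c N) d < \<epsilon> / 3) sequentially"
    using tendstoD[OF \<tau>, of "\<epsilon> / 3"] tendstoD[OF c, of "\<epsilon> / 3"] \<epsilon> by (simp add: eventually_conj)
  then obtain N where N: "dist (\<tau> N) 0 < \<epsilon> / 3" "dist (c N) d < \<epsilon> / 3"
    by (auto simp: eventually_sequentially)
  have "eventually (\<lambda>n. dist (b N n) (c N) < \<epsilon> / 3) sequentially"
    using tendstoD[OF b[of N], of "\<epsilon> / 3"] \<epsilon> by simp
  then show "eventually (\<lambda>n. dist (a n) d < \<epsilon>) sequentially"
    using approx[of N]
  proof eventually_elim
    case (elim n)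
    then show ?case using N unfolding dist_real_def by linarith
  qed
qed

text \<open>
  Because of this Lipschitz bound a Laplace transform of a squared norm changes little if the vector
  is perturbed by a small amount in mean or in probability.
\<close>

lemma exp_neg_square_lipschitz:
  fixes k x y :: real
  assumes k: "0 \<le> k"
  shows "\<bar>exp (- (k * x\<^sup>2)) - exp (- (k * y\<^sup>2))\<bar> \<le> (k + 1) * \<bar>x - y\<bar>"
proof -
  have "norm (exp (- (k * x\<^sup>2)) - exp (- (k * y\<^sup>2))) \<le> (k + 1) * norm (x - y)"
  proof (rule field_differentiable_bound[where S = UNIV and f' = "\<lambda>u. - (2 * k * u) * exp (- (k * u\<^sup>2))"])
    fix u :: real
    show "((\<lambda>x. exp (- (k * x\<^sup>2))) has_field_derivative - (2 * k * u) * exp (- (k * u\<^sup>2))) (at u within UNIV)"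
      by (auto intro!: derivative_eq_intros)
    have "2 * \<bar>u\<bar> \<le> 1 + u\<^sup>2"
      using zero_le_power2[of "\<bar>u\<bar> - 1"] by (simp add: power2_eq_square algebra_simps)
    then have "k * (2 * \<bar>u\<bar>) \<le> k * (1 + u\<^sup>2)" using k by (rule mult_left_mono)
    also have "\<dots> \<le> (k + 1) * (1 + k * u\<^sup>2)" using k by (simp add: algebra_simps)
    also have "\<dots> \<le> (k + 1) * exp (k * u\<^sup>2)" using k by (intro mult_left_mono exp_ge_add_one_self) simp
    finally have "k * (2 * \<bar>u\<bar>) * exp (- (k * u\<^sup>2)) \<le> (k + 1) * exp (k * u\<^sup>2) * exp (- (k * u\<^sup>2))"
      by (rule mult_right_mono) simp
    also have "\<dots> = k + 1" by (simp add: exp_minus)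
    finally show "norm (- (2 * k * u) * exp (- (k * u\<^sup>2))) \<le> k + 1"
      using k by (simp add: abs_mult mult_ac)
  qed auto
  then show ?thesis by simp
qed

lemma (in prob_space) expectation_abs_le_sqrt:
  fixes X :: "'a \<Rightarrow> real"
  assumes X: "X \<in> borel_measurable M" "integrable M (\<lambda>x. (X x)\<^sup>2)"
  shows "expectation (\<lambda>x. \<bar>X x\<bar>) \<le> sqrt (expectation (\<lambda>x. (X x)\<^sup>2))"
proof -
  have i: "integrable M (\<lambda>x. \<bar>X x\<bar>)"
    using square_integrable_imp_integrable[OF X] by simp
  have "0 \<le> variance (\<lambda>x. \<bar>X x\<bar>)" by (rule variance_positive)
  also have "variance (\<lambda>x. \<bar>X x\<bar>) = expectation (\<lambda>x. (X x)\<^sup>2) - (expectation (\<lambda>x. \<bar>X x\<bar>))\<^sup>2"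
    using i X by (subst variance_eq) auto
  finally show ?thesis by (intro real_le_rsqrt) simp
qed

lemma inner_normalized_sum: "u \<bullet> normalized_sum n x = normalized_sum n (\<lambda>i. u \<bullet> x i)"
  by (simp add: normalized_sum_def inner_sum_right)

lemma linear_normalized_sum:
  "linear f \<Longrightarrow> f (normalized_sum n x) = normalized_sum n (\<lambda>i. f (x i))"
  by (simp add: normalized_sum_def linear_cmul linear_sum)

locale hilbert_clt = spectral_vector M W \<omega> e + P: gaussian_sequence P Z
  for M :: "'w measure" and W :: "'w \<Rightarrow> 'h::{real_inner,banach,second_countable_topology}"
    and \<omega> e and P :: "'p measure" and Z
begin

text \<open>
  With the Gaussian vector \<open>G = (\<Sum>j. sqrt (\<omega> j) * Z j * e j)\<close>, the variable \<open>limit_var h\<close> below is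
  \<open>\<parallel>G + h\<parallel>\<^sup>2\<close> expanded into coordinates. Only the scalar series is formed, so no Gaussian vector has to
  be constructed, and the part of \<open>h\<close> orthogonal to all eigenvectors is accounted for by \<open>\<parallel>h\<parallel>\<^sup>2\<close>.
\<close>

definition limit_term :: "'h \<Rightarrow> nat \<Rightarrow> 'p \<Rightarrow> real" where
  "limit_term h j p = \<omega> j * (Z j p)\<^sup>2 + 2 * sqrt (\<omega> j) * (h \<bullet> e j) * Z j p"

definition limit_var :: "'h \<Rightarrow> 'p \<Rightarrow> real" where
  "limit_var h p = (norm h)\<^sup>2 + (\<Sum>j. limit_term h j p)"

lemma measurable_limit_term [measurable]: "limit_term h j \<in> borel_measurable P"
  unfolding limit_term_def[abs_def] by measurable

lemma measurable_limit_var [measurable]: "limit_var h \<in> borel_measurable P"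
  unfolding limit_var_def[abs_def] by measurable

lemma Z_second_moment: "integrable P (\<lambda>p. (Z j p)\<^sup>2)" "P.expectation (\<lambda>p. (Z j p)\<^sup>2) = 1"
proof -
  have i: "integrable (distr P borel (Z j)) (\<lambda>x. x\<^sup>2)"
    and e: "(\<integral>x. x\<^sup>2 \<partial>distr P borel (Z j)) = 1"
    using integrable_std_normal_distribution_moment[of 2] std_normal_distribution_even_moments[of 1]
    by (simp_all add: P.distr_Z)
  show "integrable P (\<lambda>p. (Z j p)\<^sup>2)" using i by (simp add: integrable_distr_eq)
  show "P.expectation (\<lambda>p. (Z j p)\<^sup>2) = 1" using e by (simp add: integral_distr)
qed

text \<open>
  The expectation of the series is \<open>\<Sum>j. \<omega> j\<close>, which is finite.
\<close>

lemma AE_summable_\<omega>_Z: "AE p in P. summable (\<lambda>j. \<omega> j * (Z j p)\<^sup>2)"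
proof -
  have "(\<integral>\<^sup>+p. (\<Sum>j. ennreal (\<omega> j * (Z j p)\<^sup>2)) \<partial>P) = (\<Sum>j. \<integral>\<^sup>+p. ennreal (\<omega> j * (Z j p)\<^sup>2) \<partial>P)"
    by (rule nn_integral_suminf) measurable
  also have "\<dots> = (\<Sum>j. ennreal (\<omega> j))"
  proof (rule suminf_cong)
    fix j
    have "(\<integral>\<^sup>+p. ennreal (\<omega> j * (Z j p)\<^sup>2) \<partial>P) = ennreal (P.expectation (\<lambda>p. \<omega> j * (Z j p)\<^sup>2))"
      using \<omega>_nonneg Z_second_moment(1) by (intro nn_integral_eq_integral) auto
    then show "(\<integral>\<^sup>+p. ennreal (\<omega> j * (Z j p)\<^sup>2) \<partial>P) = ennreal (\<omega> j)"
      by (simp add: Z_second_moment(2))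
  qed
  also have "\<dots> = ennreal (\<Sum>j. \<omega> j)"
    using suminf_ennreal2[OF \<omega>_nonneg summable_\<omega>] .
  finally have "(\<integral>\<^sup>+p. (\<Sum>j. ennreal (\<omega> j * (Z j p)\<^sup>2)) \<partial>P) \<noteq> \<infinity>" by simp
  then have "AE p in P. (\<Sum>j. ennreal (\<omega> j * (Z j p)\<^sup>2)) \<noteq> \<infinity>"
    by (rule nn_integral_noteq_infinite[rotated]) measurable
  then show ?thesis
  proof eventually_elim
    case (elim p)
    then show ?case using \<omega>_nonneg by (intro summable_suminf_not_top) auto
  qed
qed

text \<open>
  The arithmetic-geometric mean inequality with a free weight: \<open>c = 1\<close> gives convergence of the
  mixed terms, \<open>c = 2\<close> leaves half of \<open>\<parallel>h\<parallel>\<^sup>2\<close> in the lower bound for \<open>limit_var h\<close>.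
\<close>

lemma abs_cross_term_le: "\<bar>2 * sqrt (\<omega> j) * (h \<bullet> e j) * Z j p\<bar> \<le> c * (\<omega> j * (Z j p)\<^sup>2) + (h \<bullet> e j)\<^sup>2 / c"
  if c: "0 < c"
proof -
  define a where "a = sqrt c * \<bar>sqrt (\<omega> j) * Z j p\<bar>"
  define b where "b = \<bar>h \<bullet> e j\<bar> / sqrt c"
  have "0 \<le> (a - b)\<^sup>2" by simp
  then have "2 * (a * b) \<le> a\<^sup>2 + b\<^sup>2" by (simp add: power2_eq_square algebra_simps)
  moreover have "a * b = \<bar>sqrt (\<omega> j) * (h \<bullet> e j) * Z j p\<bar>"
    using c by (simp add: a_def b_def abs_mult)
  moreover have "a\<^sup>2 = c * (\<omega> j * (Z j p)\<^sup>2)" "b\<^sup>2 = (h \<bullet> e j)\<^sup>2 / c"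
    using c \<omega>_nonneg by (simp_all add: a_def b_def power_mult_distrib power_divide)
  ultimately show ?thesis by (simp add: abs_mult)
qed

lemma summable_limit_term:
  assumes "summable (\<lambda>j. \<omega> j * (Z j p)\<^sup>2)"
  shows "summable (\<lambda>j. limit_term h j p)"
proof -
  have "summable (\<lambda>j. 2 * sqrt (\<omega> j) * (h \<bullet> e j) * Z j p)"
  proof (rule summable_comparison_test'[where N = 0])
    show "summable (\<lambda>j. \<omega> j * (Z j p)\<^sup>2 + (h \<bullet> e j)\<^sup>2)"
      using assms summable_bessel by (rule summable_add)
    show "norm (2 * sqrt (\<omega> j) * (h \<bullet> e j) * Z j p) \<le> \<omega> j * (Z j p)\<^sup>2 + (h \<bullet> e j)\<^sup>2" for j
      using abs_cross_term_le[of 1 j h p] by simp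
  qed
  then show ?thesis unfolding limit_term_def using assms by (intro summable_add)
qed

text \<open>
  Completing the squares exhibits the partial sums as nonnegative, by Bessel's inequality, and puts
  them into the form that truncated vectors have in \<open>norm_trunc_shift\<close>.
\<close>

lemma limit_partial_sum_eq:
  "(norm h)\<^sup>2 + (\<Sum>j<N. limit_term h j p)
     = (\<Sum>j<N. (sqrt (\<omega> j) * Z j p + h \<bullet> e j)\<^sup>2) + ((norm h)\<^sup>2 - (\<Sum>j<N. (h \<bullet> e j)\<^sup>2))"
proof -
  have "(sqrt (\<omega> j) * Z j p + h \<bullet> e j)\<^sup>2 = limit_term h j p + (h \<bullet> e j)\<^sup>2" for j
    using \<omega>_nonneg by (simp add: limit_term_def power2_sum power_mult_distrib)
  then show ?thesis by (simp add: sum.distrib)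
qed

lemma limit_partial_sum_nonneg: "0 \<le> (norm h)\<^sup>2 + (\<Sum>j<N. limit_term h j p)"
  unfolding limit_partial_sum_eq using bessel[where x = h and N = N] by (intro add_nonneg_nonneg sum_nonneg) auto

lemma limit_partial_sum_tendsto:
  assumes "summable (\<lambda>j. \<omega> j * (Z j p)\<^sup>2)"
  shows "(\<lambda>N. (norm h)\<^sup>2 + (\<Sum>j<N. limit_term h j p)) \<longlonglongrightarrow> limit_var h p"
  unfolding limit_var_def
  by (intro tendsto_add tendsto_const summable_LIMSEQ summable_limit_term assms)

lemma AE_limit_var_nonneg: "AE p in P. 0 \<le> limit_var h p"
  using AE_summable_\<omega>_Z
proof eventually_elim
  case (elim p)
  show ?case
    by (rule LIMSEQ_le_const[OF limit_partial_sum_tendsto[OF elim]]) (use limit_partial_sum_nonneg in blast)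
qed

lemma norm_trunc_shift:
  "(norm (ortho_trunc e N x + h))\<^sup>2
     = (\<Sum>j<N. (x \<bullet> e j + h \<bullet> e j)\<^sup>2) + ((norm h)\<^sup>2 - (\<Sum>j<N. (h \<bullet> e j)\<^sup>2))"
proof -
  have "(norm (ortho_trunc e N x + h))\<^sup>2
      = (norm (ortho_trunc e N x))\<^sup>2 + 2 * (ortho_trunc e N x \<bullet> h) + (norm h)\<^sup>2"
    by (simp add: power2_norm_eq_inner inner_add_left inner_add_right inner_commute)
  then show ?thesis
    by (simp add: norm_ortho_trunc inner_ortho_trunc power2_sum sum.distrib sum_distrib_left mult.assoc)
qed

text \<open>
  Samples are assumed to have size at least 1, since size 0 carries no information; limits are
  therefore taken along the sizes \<open>Suc n\<close>.
\<close>

context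
  fixes S :: "nat \<Rightarrow> 's measure" and Ws :: "nat \<Rightarrow> nat \<Rightarrow> 's \<Rightarrow> 'h"
  assumes iid: "\<And>n. 1 \<le> n \<Longrightarrow> iid_copies (S n) n (Ws n) M W"
begin

lemma S_prob: "1 \<le> n \<Longrightarrow> prob_space (S n)"
  using iid by (simp add: iid_copies_def)

lemma measurable_normalized_sum: "1 \<le> n \<Longrightarrow> (\<lambda>s. normalized_sum n (\<lambda>i. Ws n i s)) \<in> borel_measurable (S n)"
  by (rule borel_measurable_normalized_sum[OF iid])

lemma projected_char_tendsto:
  "(\<lambda>n. \<integral>s. iexp (u \<bullet> normalized_sum (Suc n) (\<lambda>i. Ws (Suc n) i s)) \<partial>S (Suc n))
     \<longlonglongrightarrow> of_real (exp (- (expectation (\<lambda>w. (u \<bullet> W w)\<^sup>2) / 2)))"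
proof -
  have iW: "integrable M W"
    using prob_space_axioms W_measurable W_square_integrable by (rule square_norm_integrable_imp_integrable)
  have eq: "(\<integral>s. iexp (u \<bullet> normalized_sum (Suc n) (\<lambda>i. Ws (Suc n) i s)) \<partial>S (Suc n))
      = char (distr M borel (\<lambda>w. u \<bullet> W w)) (1 / sqrt (real (Suc n))) ^ Suc n" for n
    unfolding inner_normalized_sum
    by (rule normalized_sum_char[OF iid_copies_compose[OF iid W_measurable, of "Suc n" "\<lambda>x. u \<bullet> x"]])
       simp_all
  have "(\<lambda>n. char (distr M borel (\<lambda>w. u \<bullet> W w)) (1 / sqrt (real n)) ^ n)
      \<longlonglongrightarrow> of_real (exp (- (1\<^sup>2 * expectation (\<lambda>w. (u \<bullet> W w)\<^sup>2) / 2)))"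
    by (intro char_power_tendsto_gaussian prob_space_axioms square_integrable_inner)
       (simp_all add: iW W_mean)
  from LIMSEQ_Suc[OF this] show ?thesis unfolding eq by (simp only: power_one mult_1)
qed

text \<open>
  The mixture formula is applied twice, to the coordinates of the normalized sum and to the Gaussian
  coordinates. Given the mixing direction \<open>\<xi> p\<close>, the two inner integrals are a characteristic function of a
  one-dimensional normalized sum and its limit; dominated convergence in \<open>p\<close> does the rest.
\<close>

lemma projected_laplace_tendsto:
  assumes k: "0 \<le> k"
  shows "(\<lambda>n. \<integral>s. exp (- (k * (\<Sum>j<N. (normalized_sum (Suc n) (\<lambda>i. Ws (Suc n) i s) \<bullet> e j + h j)\<^sup>2))) \<partial>S (Suc n))
     \<longlonglongrightarrow> P.expectation (\<lambda>p. exp (- (k * (\<Sum>j<N. (sqrt (\<omega> j) * Z j p + h j)\<^sup>2))))"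
proof -
  define r where "r = sqrt (2 * k)"
  define G where "G n s = normalized_sum (Suc n) (\<lambda>i. Ws (Suc n) i s)" for n s
  have [measurable]: "G n \<in> borel_measurable (S (Suc n))" for n
    using measurable_normalized_sum[of "Suc n"] by (simp add: G_def[abs_def])
  define \<xi> where "\<xi> p = (\<Sum>j<N. (r * Z j p) *\<^sub>R e j)" for p
  define A where "A p = iexp (\<Sum>j<N. r * h j * Z j p)" for p
  define B where "B n p = (\<integral>s. iexp (\<xi> p \<bullet> G n s) \<partial>S (Suc n))" for n p
  define C where "C p = complex_of_real (exp (- (expectation (\<lambda>w. (\<xi> p \<bullet> W w)\<^sup>2) / 2)))" for p
  have S: "prob_space (S (Suc n))" for n by (rule S_prob) simp
  have \<xi>G: "\<xi> p \<bullet> x = (\<Sum>j<N. (r * Z j p) * (x \<bullet> e j))" for p x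
    by (simp add: \<xi>_def inner_sum_left inner_commute[of x])
  have \<xi>W: "expectation (\<lambda>w. (\<xi> p \<bullet> W w)\<^sup>2) = (\<Sum>j<N. \<omega> j * (r * Z j p)\<^sup>2)" for p
    unfolding \<xi>_def by (rule expectation_inner_trunc)
  have lhs: "of_real (\<integral>s. exp (- (k * (\<Sum>j<N. (G n s \<bullet> e j + h j)\<^sup>2))) \<partial>S (Suc n))
      = P.expectation (\<lambda>p. A p * B n p)" for n
    unfolding A_def B_def \<xi>G r_def
    by (rule P.expectation_exp_square_mixing[OF S _ k]) measurable
  have rhs: "of_real (P.expectation (\<lambda>p. exp (- (k * (\<Sum>j<N. (sqrt (\<omega> j) * Z j p + h j)\<^sup>2)))))
      = P.expectation (\<lambda>p. A p * C p)"
  proof -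
    have C: "(\<integral>q. iexp (\<Sum>j<N. (r * Z j p) * (sqrt (\<omega> j) * Z j q)) \<partial>P) = C p" for p
    proof -
      have "(\<Sum>j<N. (r * Z j p) * (sqrt (\<omega> j) * Z j q)) = (\<Sum>j<N. (r * Z j p * sqrt (\<omega> j)) * Z j q)" for q
        by (simp add: mult.assoc)
      moreover have "(r * Z j p * sqrt (\<omega> j))\<^sup>2 = \<omega> j * (r * Z j p)\<^sup>2" for j
        using \<omega>_nonneg by (simp add: power_mult_distrib)
      ultimately show ?thesis
        by (simp only: P.expectation_iexp_sum C_def \<xi>W minus_divide_left)
    qed
    show ?thesis
      unfolding A_def C[symmetric] unfolding r_def
      by (rule P.expectation_exp_square_mixing[OF P.prob_space_axioms _ k]) measurable
  qed
  have "(\<lambda>n. P.expectation (\<lambda>p. A p * B n p)) \<longlonglongrightarrow> P.expectation (\<lambda>p. A p * C p)"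
  proof (rule integral_dominated_convergence[where w = "\<lambda>_. 1"])
    show "(\<lambda>p. A p * C p) \<in> borel_measurable P"
      unfolding A_def C_def \<xi>W by measurable
    show "(\<lambda>p. A p * B n p) \<in> borel_measurable P" for n
    proof -
      interpret S: prob_space "S (Suc n)" by (rule S)
      show ?thesis unfolding A_def B_def \<xi>G by measurable
    qed
    show "AE p in P. (\<lambda>n. A p * B n p) \<longlonglongrightarrow> A p * C p"
      unfolding B_def C_def G_def by (intro AE_I2 tendsto_mult tendsto_const projected_char_tendsto)
    show "AE p in P. norm (A p * B n p) \<le> 1" for n
    proof (rule AE_I2)
      fix p
      interpret S: prob_space "S (Suc n)" by (rule S)
      have "norm (B n p) \<le> (\<integral>s. norm (iexp (\<xi> p \<bullet> G n s)) \<partial>S (Suc n))"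
        unfolding B_def by (rule integral_norm_bound)
      also have "\<dots> = 1" by (simp add: S.prob_space)
      finally show "norm (A p * B n p) \<le> 1" by (simp add: norm_mult A_def)
    qed
  qed simp
  then show ?thesis
    unfolding lhs[symmetric] rhs[symmetric] tendsto_of_real_iff G_def .
qed

text \<open>
  For the first \<open>N\<close> coordinates this is \<open>projected_laplace_tendsto\<close>. The error of that truncation is at most a constant times the square
  root of the tail of the trace, uniformly in the sample size, so the limits in \<open>n\<close> and
  \<open>N\<close> may be interchanged.
\<close>

theorem shifted_laplace_tendsto:
  assumes k: "0 \<le> k"
  shows "(\<lambda>n. \<integral>s. exp (- (k * (norm (normalized_sum (Suc n) (\<lambda>i. Ws (Suc n) i s) + h))\<^sup>2)) \<partial>S (Suc n))
     \<longlonglongrightarrow> P.expectation (\<lambda>p. exp (- (k * limit_var h p)))"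
proof -
  define G where "G n s = normalized_sum (Suc n) (\<lambda>i. Ws (Suc n) i s)" for n s
  have [measurable]: "G n \<in> borel_measurable (S (Suc n))" for n
    using measurable_normalized_sum[of "Suc n"] by (simp add: G_def[abs_def])
  have S: "prob_space (S (Suc n))" for n by (rule S_prob) simp
  define \<tau> where "\<tau> N = expectation (\<lambda>w. (norm (W w - ortho_trunc e N (W w)))\<^sup>2)" for N
  define q where "q N = (norm h)\<^sup>2 - (\<Sum>j<N. (h \<bullet> e j)\<^sup>2)" for N
  have q0: "0 \<le> q N" for N using bessel[where x = h and N = N] by (simp add: q_def)
  show ?thesis
    unfolding G_def[symmetric]
  proof (rule tendsto_of_uniformly_close[where
        b = "\<lambda>N n. \<integral>s. exp (- (k * (norm (ortho_trunc e N (G n s) + h))\<^sup>2)) \<partial>S (Suc n)"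
      and \<tau> = "\<lambda>N. (k + 1) * sqrt (\<tau> N)"
      and c = "\<lambda>N. P.expectation (\<lambda>p. exp (- (k * ((norm h)\<^sup>2 + (\<Sum>j<N. limit_term h j p)))))"])
    fix N
    have fac: "exp (- (k * (x + q N))) = exp (- (k * q N)) * exp (- (k * x))" for x
      by (simp add: algebra_simps flip: exp_add)
    have "(\<lambda>n. exp (- (k * q N)) * (\<integral>s. exp (- (k * (\<Sum>j<N. (G n s \<bullet> e j + h \<bullet> e j)\<^sup>2))) \<partial>S (Suc n)))
       \<longlonglongrightarrow> exp (- (k * q N)) * P.expectation (\<lambda>p. exp (- (k * (\<Sum>j<N. (sqrt (\<omega> j) * Z j p + h \<bullet> e j)\<^sup>2))))"
      unfolding G_def by (intro tendsto_mult tendsto_const projected_laplace_tendsto k)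
    then show "(\<lambda>n. \<integral>s. exp (- (k * (norm (ortho_trunc e N (G n s) + h))\<^sup>2)) \<partial>S (Suc n))
       \<longlonglongrightarrow> P.expectation (\<lambda>p. exp (- (k * ((norm h)\<^sup>2 + (\<Sum>j<N. limit_term h j p)))))"
      unfolding norm_trunc_shift limit_partial_sum_eq q_def[symmetric] fac by simp
  next
    show "(\<lambda>N. P.expectation (\<lambda>p. exp (- (k * ((norm h)\<^sup>2 + (\<Sum>j<N. limit_term h j p))))))
        \<longlonglongrightarrow> P.expectation (\<lambda>p. exp (- (k * limit_var h p)))"
    proof (rule integral_dominated_convergence[where w = "\<lambda>_. 1"])
      show "AE p in P. (\<lambda>N. exp (- (k * ((norm h)\<^sup>2 + (\<Sum>j<N. limit_term h j p)))))
          \<longlonglongrightarrow> exp (- (k * limit_var h p))"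
        using AE_summable_\<omega>_Z
      proof eventually_elim
        case (elim p)
        show ?case
          by (intro tendsto_exp tendsto_minus tendsto_mult tendsto_const limit_partial_sum_tendsto elim)
      qed
      show "AE p in P. norm (exp (- (k * ((norm h)\<^sup>2 + (\<Sum>j<N. limit_term h j p))))) \<le> 1" for N
        using k limit_partial_sum_nonneg by (intro AE_I2) simp
    qed simp_all
  next
    have "(\<lambda>N. (k + 1) * sqrt (\<tau> N)) \<longlonglongrightarrow> (k + 1) * sqrt 0"
      unfolding \<tau>_def by (intro tendsto_mult tendsto_const tendsto_real_sqrt tail_tendsto_0)
    then show "(\<lambda>N. (k + 1) * sqrt (\<tau> N)) \<longlonglongrightarrow> 0" by simp
  next
    fix N
    have "\<bar>(\<integral>s. exp (- (k * (norm (G n s + h))\<^sup>2)) \<partial>S (Suc n))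
        - (\<integral>s. exp (- (k * (norm (ortho_trunc e N (G n s) + h))\<^sup>2)) \<partial>S (Suc n))\<bar> \<le> (k + 1) * sqrt (\<tau> N)" for n
    proof -
      interpret S: prob_space "S (Suc n)" by (rule S)
      define f where "f x = x - ortho_trunc e N x" for x
      have lin: "linear f"
        unfolding f_def[abs_def] by (intro linear_compose_sub linear_ident linear_ortho_trunc)
      have [measurable]: "f \<in> borel_measurable borel" unfolding f_def[abs_def] by measurable
      have fG: "f (G n s) = normalized_sum (Suc n) (\<lambda>i. f (Ws (Suc n) i s))" for s
        unfolding G_def by (rule linear_normalized_sum[OF lin])
      have iW: "integrable M W"
        using prob_space_axioms W_measurable W_square_integrable by (rule square_norm_integrable_imp_integrable)
      have fW0: "expectation (\<lambda>w. f (W w)) = 0"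
      proof -
        have "expectation (\<lambda>w. ortho_trunc e N (W w)) = ortho_trunc e N (expectation W)"
          unfolding ortho_trunc_def using iW by simp
        moreover have "integrable M (\<lambda>w. ortho_trunc e N (W w))"
          unfolding ortho_trunc_def using iW by simp
        ultimately show ?thesis
          unfolding f_def using iW by (simp add: W_mean linear_0[OF linear_ortho_trunc])
      qed
      have fW2: "integrable M (\<lambda>w. (norm (f (W w)))\<^sup>2)"
      proof (rule Bochner_Integration.integrable_bound[OF W_square_integrable])
        show "AE w in M. norm ((norm (f (W w)))\<^sup>2) \<le> norm ((norm (W w))\<^sup>2)"
          using norm_diff_ortho_trunc_le by (intro AE_I2) (simp add: f_def power_mono)
      qed simp
      note copies = iid_copies_compose[OF iid W_measurable, of "Suc n" f]
      have fG2: "integrable (S (Suc n)) (\<lambda>s. (norm (f (G n s)))\<^sup>2)"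
          "S.expectation (\<lambda>s. (norm (f (G n s)))\<^sup>2) = \<tau> N"
        unfolding fG \<tau>_def f_def[symmetric]
        by (rule normalized_sum_second_moment[OF copies]; use fW0 fW2 in simp)+
      have b: "integrable (S (Suc n)) (\<lambda>s. exp (- (k * (norm (g s))\<^sup>2)))"
        if [measurable]: "g \<in> borel_measurable (S (Suc n))" for g :: "'s \<Rightarrow> 'h"
        using k by (intro S.integrable_const_bound[of _ 1]) auto
      have ifG: "integrable (S (Suc n)) (\<lambda>s. norm (f (G n s)))"
        by (rule S.square_integrable_imp_integrable[OF _ fG2(1)]) measurable
      have "\<bar>\<integral>s. exp (- (k * (norm (G n s + h))\<^sup>2)) - exp (- (k * (norm (ortho_trunc e N (G n s) + h))\<^sup>2)) \<partial>S (Suc n)\<bar>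
         \<le> (\<integral>s. (k + 1) * norm (f (G n s)) \<partial>S (Suc n))"
      proof (intro integral_abs_bound[THEN order_trans] integral_mono)
        fix s
        have "\<bar>norm (G n s + h) - norm (ortho_trunc e N (G n s) + h)\<bar> \<le> norm (f (G n s))"
          using norm_triangle_ineq3[of "G n s + h" "ortho_trunc e N (G n s) + h"] by (simp add: f_def)
        then have "(k + 1) * \<bar>norm (G n s + h) - norm (ortho_trunc e N (G n s) + h)\<bar> \<le> (k + 1) * norm (f (G n s))"
          using k by (intro mult_left_mono) auto
        with exp_neg_square_lipschitz[OF k]
        show "\<bar>exp (- (k * (norm (G n s + h))\<^sup>2)) - exp (- (k * (norm (ortho_trunc e N (G n s) + h))\<^sup>2))\<bar>
           \<le> (k + 1) * norm (f (G n s))" by (rule order_trans)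
        show "integrable (S (Suc n)) (\<lambda>s. (k + 1) * norm (f (G n s)))" using ifG by simp
      qed (intro integrable_abs Bochner_Integration.integrable_diff b; measurable)
      also have "\<dots> = (k + 1) * S.expectation (\<lambda>s. norm (f (G n s)))" by simp
      also have "\<dots> \<le> (k + 1) * sqrt (\<tau> N)"
        using S.expectation_abs_le_sqrt[of "\<lambda>s. norm (f (G n s))"] fG2 k by (intro mult_left_mono) auto
      finally show ?thesis
        by (subst (asm) Bochner_Integration.integral_diff) (intro b, measurable, intro b, measurable)
    qed
    then show "eventually (\<lambda>n. \<bar>(\<integral>s. exp (- (k * (norm (G n s + h))\<^sup>2)) \<partial>S (Suc n))
        - (\<integral>s. exp (- (k * (norm (ortho_trunc e N (G n s) + h))\<^sup>2)) \<partial>S (Suc n))\<bar>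
          \<le> (k + 1) * sqrt (\<tau> N)) sequentially"
      by (intro always_eventually allI)
  qed
qed

text \<open>
  By the Lipschitz bound \<open>exp_neg_square_lipschitz\<close>, a perturbation tending to zero in probability does
  not affect the limits of the Laplace transforms; these limits determine the one in distribution.
\<close>

theorem norm_square_prob_tendsto:
  assumes D [measurable]: "\<And>n. D n \<in> borel_measurable (S (Suc n))"
    and close: "\<And>c. 0 < c \<Longrightarrow> (\<lambda>n. measure (S (Suc n)) {s \<in> space (S (Suc n)).
       norm (D n s - (normalized_sum (Suc n) (\<lambda>i. Ws (Suc n) i s) + h)) > c}) \<longlonglongrightarrow> 0"
    and no_atom: "measure P {p \<in> space P. limit_var h p = z} = 0"
  shows "(\<lambda>n. measure (S (Suc n)) {s \<in> space (S (Suc n)). (norm (D n s))\<^sup>2 > z})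
     \<longlonglongrightarrow> measure P {p \<in> space P. limit_var h p > z}"
proof (rule exp_moments_imp_prob_greater_tendsto)
  show S: "prob_space (S (Suc n))" for n by (rule S_prob) simp
  define G where "G n s = normalized_sum (Suc n) (\<lambda>i. Ws (Suc n) i s) + h" for n s
  have [measurable]: "G n \<in> borel_measurable (S (Suc n))" for n
    using measurable_normalized_sum[of "Suc n"] by (simp add: G_def[abs_def])
  fix k :: nat
  have lim: "(\<lambda>n. \<integral>s. exp (- (real k * (norm (G n s))\<^sup>2)) \<partial>S (Suc n))
       \<longlonglongrightarrow> P.expectation (\<lambda>p. exp (- (real k * limit_var h p)))"
    unfolding G_def by (rule shifted_laplace_tendsto) simp
  show "(\<lambda>n. \<integral>s. exp (- (real k * (norm (D n s))\<^sup>2)) \<partial>S (Suc n))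
       \<longlonglongrightarrow> P.expectation (\<lambda>p. exp (- (real k * limit_var h p)))"
  proof (rule tendsto_of_uniformly_close[where
        b = "\<lambda>N n. \<integral>s. exp (- (real k * (norm (G n s))\<^sup>2)) \<partial>S (Suc n)"
      and \<tau> = "\<lambda>N. (real k + 2) / real (Suc N)", OF _ _ lim tendsto_const])
    show "(\<lambda>N. (real k + 2) / real (Suc N)) \<longlonglongrightarrow> 0"
      using LIMSEQ_Suc[OF lim_const_over_n[of "real k + 2"]] by simp
    fix N
    define c where "c = 1 / real (Suc N)"
    have c: "0 < c" by (simp add: c_def)
    define bad where "bad n = {s \<in> space (S (Suc n)). norm (D n s - G n s) > c}" for n
    have [measurable]: "bad n \<in> sets (S (Suc n))" for n unfolding bad_def by measurable
    have bound: "\<bar>(\<integral>s. exp (- (real k * (norm (D n s))\<^sup>2)) \<partial>S (Suc n))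
        - (\<integral>s. exp (- (real k * (norm (G n s))\<^sup>2)) \<partial>S (Suc n))\<bar>
       \<le> (real k + 1) * c + measure (S (Suc n)) (bad n)" for n
    proof -
      interpret S: prob_space "S (Suc n)" by (rule S)
      have b: "integrable (S (Suc n)) (\<lambda>s. exp (- (real k * (norm (g s))\<^sup>2)))"
        if [measurable]: "g \<in> borel_measurable (S (Suc n))" for g :: "'s \<Rightarrow> 'h"
        by (intro S.integrable_const_bound[of _ 1]) auto
      have ib: "integrable (S (Suc n)) (\<lambda>s. indicator (bad n) s :: real)"
        by (intro S.integrable_const_bound[of _ 1]) (auto split: split_indicator)
      have "\<bar>\<integral>s. exp (- (real k * (norm (D n s))\<^sup>2)) - exp (- (real k * (norm (G n s))\<^sup>2)) \<partial>S (Suc n)\<bar>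
         \<le> (\<integral>s. (real k + 1) * c + indicator (bad n) s \<partial>S (Suc n))"
      proof (intro integral_abs_bound[THEN order_trans] integral_mono)
        fix s assume s: "s \<in> space (S (Suc n))"
        have range: "0 < exp (- (real k * x\<^sup>2))" "exp (- (real k * x\<^sup>2)) \<le> 1" for x :: real
          by simp_all
        let ?l = "\<bar>exp (- (real k * (norm (D n s))\<^sup>2)) - exp (- (real k * (norm (G n s))\<^sup>2))\<bar>"
        show "?l \<le> (real k + 1) * c + indicator (bad n) s"
        proof (cases "s \<in> bad n")
          case True
          have "?l \<le> 1"
            using range[of "norm (D n s)"] range[of "norm (G n s)"] by linarith
          moreover have "0 \<le> (real k + 1) * c" using c by simp
          ultimately show ?thesis using True by simp
        next
          case False
          then have "norm (D n s - G n s) \<le> c" using s by (simp add: bad_def)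
          then have "\<bar>norm (D n s) - norm (G n s)\<bar> \<le> c"
            using norm_triangle_ineq3 order_trans by blast
          then have "(real k + 1) * \<bar>norm (D n s) - norm (G n s)\<bar> \<le> (real k + 1) * c"
            by (intro mult_left_mono) auto
          then show ?thesis
            using order_trans[OF exp_neg_square_lipschitz[of "real k" "norm (D n s)" "norm (G n s)"]] False
            by simp
        qed
      next
        show "integrable (S (Suc n)) (\<lambda>s. (real k + 1) * c + indicator (bad n) s)"
          using ib by (rule Bochner_Integration.integrable_add[OF S.integrable_const])
      qed (intro integrable_abs Bochner_Integration.integrable_diff b; measurable)
      also have "\<dots> = (real k + 1) * c + measure (S (Suc n)) (bad n)"
        using ib by (simp add: S.prob_space)
      finally show ?thesis
        by (subst (asm) Bochner_Integration.integral_diff) (intro b, measurable, intro b, measurable)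
    qed
    have "(\<lambda>n. measure (S (Suc n)) (bad n)) \<longlonglongrightarrow> 0"
      using close[OF c] by (simp add: bad_def G_def)
    then have "eventually (\<lambda>n. measure (S (Suc n)) (bad n) < c) sequentially"
      using c by (rule order_tendstoD(2))
    then show "eventually (\<lambda>n. \<bar>(\<integral>s. exp (- (real k * (norm (D n s))\<^sup>2)) \<partial>S (Suc n))
        - (\<integral>s. exp (- (real k * (norm (G n s))\<^sup>2)) \<partial>S (Suc n))\<bar> \<le> (real k + 2) / real (Suc N)) sequentially"
    proof eventually_elim
      case (elim n)
      have "(real k + 2) / real (Suc N) = (real k + 1) * c + c" by (simp add: c_def field_simps)
      then show ?case using bound[of n] elim by linarith
    qed
  qed
qed (use no_atom AE_limit_var_nonneg P.prob_space_axioms in simp_all)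

end

end

section \<open>The limit law\<close>

lemma finite_quadratic_roots:
  fixes a b c :: real
  assumes "a \<noteq> 0"
  shows "finite {x. a * x\<^sup>2 + b * x + c = 0}"
proof -
  have "finite {x. poly [:c, b, a:] x = 0}" using assms by (intro poly_roots_finite) auto
  also have "{x. poly [:c, b, a:] x = 0} = {x. a * x\<^sup>2 + b * x + c = 0}"
    by (simp add: power2_eq_square algebra_simps)
  finally show ?thesis .
qed

lemma emeasure_std_normal_finite:
  assumes "finite F"
  shows "emeasure std_normal_distribution F = 0"
proof -
  have "F \<in> null_sets lborel" using assms by (rule finite_imp_null_set_lborel)
  then have "F \<in> null_sets std_normal_distribution"
    using absolutely_continuousI_density[of std_normal_density lborel]
    by (auto simp: absolutely_continuous_def)
  then show ?thesis by blast
qed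

context hilbert_clt
begin

text \<open>
  One coordinate with positive variance suffices: \<open>limit_var h\<close> is a nondegenerate quadratic polynomial
  in \<open>Z J\<close> plus a variable independent of \<open>Z J\<close>. For each value of the latter at most two values of
  \<open>Z J\<close> give the sum \<open>z\<close>, and these have probability zero.
\<close>

lemma limit_var_no_atom:
  assumes J: "\<omega> J \<noteq> 0"
  shows "measure P {p \<in> space P. limit_var h p = z} = 0"
proof -
  define r where "r j x = \<omega> j * x\<^sup>2 + 2 * sqrt (\<omega> j) * (h \<bullet> e j) * x" for j and x :: real
  define g where "g f = (norm h)\<^sup>2 + (\<Sum>j. if j = J then 0 else r j (f j))" for f
  define Y where "Y p = g (restrict (\<lambda>j. Z j p) (UNIV - {J}))" for p
  have lt: "limit_term h j p = r j (Z j p)" for j p by (simp add: limit_term_def r_def)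
  have [measurable]: "r j \<in> borel_measurable borel" for j unfolding r_def[abs_def] by measurable
  have gm: "g \<in> borel_measurable (PiM (UNIV - {J}) (\<lambda>_. borel))"
  proof -
    have "(\<lambda>f. if j = J then 0 else r j (f j)) \<in> borel_measurable (PiM (UNIV - {J}) (\<lambda>_. borel))" for j
      by (cases "j = J") simp_all
    then show ?thesis unfolding g_def[abs_def] by measurable
  qed
  have "P.indep_var (PiM {J} (\<lambda>_. borel)) (\<lambda>p. restrict (\<lambda>j. Z j p) {J})
      (PiM (UNIV - {J}) (\<lambda>_. borel)) (\<lambda>p. restrict (\<lambda>j. Z j p) (UNIV - {J}))"
    by (rule P.indep_var_restrict[OF P.Z_indep]) auto
  then have "P.indep_var borel ((\<lambda>f. f J) \<circ> (\<lambda>p. restrict (\<lambda>j. Z j p) {J}))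
      borel (g \<circ> (\<lambda>p. restrict (\<lambda>j. Z j p) (UNIV - {J})))"
    by (rule P.indep_var_compose) (auto intro!: measurable_component_singleton gm)
  then have ind: "P.indep_var borel (Z J) borel Y" by (simp add: comp_def Y_def[abs_def])
  then have [measurable]: "Y \<in> borel_measurable P" by (rule P.indep_var_rv2)
  interpret dZ: prob_space "distr P borel (Z J)" by (rule P.prob_space_distr) simp
  interpret dY: prob_space "distr P borel Y" by (rule P.prob_space_distr) simp
  interpret ZY: pair_prob_space "distr P borel (Z J)" "distr P borel Y" ..
  have prod: "distr P borel (Z J) \<Otimes>\<^sub>M distr P borel Y = distr P (borel \<Otimes>\<^sub>M borel) (\<lambda>p. (Z J p, Y p))"
    using ind by (simp add: P.indep_var_distribution_eq)
  define E where "E = {(x, y). r J x + y = z}"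
  have "E = {v \<in> space (borel \<Otimes>\<^sub>M borel). r J (fst v) + snd v = z}"
    by (auto simp: E_def space_pair_measure)
  also have "\<dots> \<in> sets (borel \<Otimes>\<^sub>M borel)" by measurable
  finally have E: "E \<in> sets (borel \<Otimes>\<^sub>M borel)" .
  have slice: "emeasure (distr P borel (Z J)) ((\<lambda>x. (x, y)) -` E) = 0" for y
  proof -
    have "(\<lambda>x. (x, y)) -` E = {x. \<omega> J * x\<^sup>2 + (2 * sqrt (\<omega> J) * (h \<bullet> e J)) * x + (y - z) = 0}"
      by (auto simp: E_def r_def)
    then have "finite ((\<lambda>x. (x, y)) -` E)" using finite_quadratic_roots[OF J] by simp
    then show ?thesis unfolding P.distr_Z by (rule emeasure_std_normal_finite)
  qed
  have "emeasure P ((\<lambda>p. (Z J p, Y p)) -` E \<inter> space P)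
      = emeasure (distr P borel (Z J) \<Otimes>\<^sub>M distr P borel Y) E"
    unfolding prod using E by (subst emeasure_distr) auto
  also have "\<dots> = 0"
    using E by (subst ZY.emeasure_pair_measure_alt2) (auto simp: slice)
  finally have null: "(\<lambda>p. (Z J p, Y p)) -` E \<inter> space P \<in> null_sets P"
    using E by (auto simp: null_sets_def intro!: measurable_sets)
  have "AE p in P. limit_var h p \<noteq> z"
    using AE_summable_\<omega>_Z AE_not_in[OF null] AE_space
  proof eventually_elim
    case (elim p)
    have s: "summable (\<lambda>j. r j (Z j p))"
      using summable_limit_term[OF elim(1), of h] by (simp add: lt)
    have "(\<lambda>j. r j (Z j p) - (if j = J then r J (Z J p) else 0)) sums ((\<Sum>j. r j (Z j p)) - r J (Z J p))"
      by (intro sums_diff summable_sums s sums_single)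
    moreover have "(\<lambda>j. r j (Z j p) - (if j = J then r J (Z J p) else 0))
        = (\<lambda>j. if j = J then 0 else r j (Z j p))" by auto
    ultimately have "(\<Sum>j. if j = J then 0 else r j (Z j p)) = (\<Sum>j. r j (Z j p)) - r J (Z J p)"
      by (metis sums_unique)
    moreover have "(\<lambda>j. if j = J then 0 else r j (restrict (\<lambda>j. Z j p) (UNIV - {J}) j))
        = (\<lambda>j. if j = J then 0 else r j (Z j p))" by auto
    ultimately have "limit_var h p = r J (Z J p) + Y p"
      by (simp add: limit_var_def Y_def g_def lt)
    then show ?case using elim by (auto simp: E_def)
  qed
  then show ?thesis by (intro P.prob_eq_0[THEN iffD2]) auto
qed

text \<open>
  The weighted bound on the mixed terms turns a large shift into a large value, up to a random
  variable that does not depend on the shift.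
\<close>

lemma limit_var_lower_bound:
  assumes s: "summable (\<lambda>j. \<omega> j * (Z j p)\<^sup>2)"
  shows "(norm h)\<^sup>2 / 2 - (\<Sum>j. \<omega> j * (Z j p)\<^sup>2) \<le> limit_var h p"
proof -
  have sq: "summable (\<lambda>j. (h \<bullet> e j)\<^sup>2)" by (rule summable_bessel)
  have "(\<Sum>j. (h \<bullet> e j)\<^sup>2) \<le> (norm h)\<^sup>2"
    using sq bessel by (intro suminf_le_const) auto
  moreover have "(\<Sum>j. - (\<omega> j * (Z j p)\<^sup>2) - (h \<bullet> e j)\<^sup>2 / 2) \<le> (\<Sum>j. limit_term h j p)"
  proof (rule suminf_le)
    fix j
    show "- (\<omega> j * (Z j p)\<^sup>2) - (h \<bullet> e j)\<^sup>2 / 2 \<le> limit_term h j p"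
      using abs_cross_term_le[of 2 j h p] by (simp add: limit_term_def abs_le_iff)
  next
    show "summable (\<lambda>j. - (\<omega> j * (Z j p)\<^sup>2) - (h \<bullet> e j)\<^sup>2 / 2)"
      by (intro summable_diff summable_minus summable_divide s sq)
  qed (rule summable_limit_term[OF s])
  moreover have "(\<Sum>j. - (\<omega> j * (Z j p)\<^sup>2) - (h \<bullet> e j)\<^sup>2 / 2)
      = - (\<Sum>j. \<omega> j * (Z j p)\<^sup>2) - (\<Sum>j. (h \<bullet> e j)\<^sup>2) / 2"
    using s sq by (simp add: suminf_diff[symmetric] suminf_minus[symmetric] suminf_divide
        summable_minus summable_divide)
  ultimately show ?thesis unfolding limit_var_def by linarith
qed

lemma limit_prob_tendsto_1:
  "((\<lambda>h. measure P {p \<in> space P. limit_var h p > z}) \<longlongrightarrow> 1) (filtercomap norm at_top)"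
proof (rule order_tendstoI)
  fix a :: real assume a: "a < 1"
  define T where "T p = (\<Sum>j. \<omega> j * (Z j p)\<^sup>2)" for p
  have [measurable]: "T \<in> borel_measurable P" unfolding T_def[abs_def] by measurable
  interpret D: real_distribution "distr P borel T" by (rule P.real_distribution_distr) simp
  have "eventually (\<lambda>t. a < cdf (distr P borel T) t) at_top"
    using order_tendstoD(1)[OF D.cdf_lim_at_top_prob a] .
  then obtain t where t: "a < cdf (distr P borel T) t" by (auto simp: eventually_at_top_linorder)
  have t': "a < measure P {p \<in> space P. T p \<le> t}"
    using t by (simp add: cdf_def measure_distr vimage_def Int_def conj_commute)
  have "a < measure P {p \<in> space P. limit_var h p > z}" if h: "norm h \<ge> 2 * (\<bar>z\<bar> + \<bar>t\<bar>) + 2" for h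
  proof -
    have "norm h * 1 \<le> norm h * norm h" using h by (intro mult_left_mono) auto
    then have h2: "(norm h)\<^sup>2 / 2 > t + z" using h by (simp add: power2_eq_square)
    have "measure P {p \<in> space P. T p \<le> t} \<le> measure P {p \<in> space P. limit_var h p > z}"
    proof (rule P.finite_measure_mono_AE)
      show "AE p in P. p \<in> {p \<in> space P. T p \<le> t} \<longrightarrow> p \<in> {p \<in> space P. limit_var h p > z}"
        using AE_summable_\<omega>_Z
      proof eventually_elim
        case (elim p)
        then show ?case using limit_var_lower_bound[OF elim, of h] h2 by (auto simp: T_def)
      qed
    qed simp
    with t' show ?thesis by linarith
  qed
  moreover have "eventually (\<lambda>h::'h. norm h \<ge> 2 * (\<bar>z\<bar> + \<bar>t\<bar>) + 2) (filtercomap norm at_top)"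
    by (intro eventually_filtercomapI eventually_ge_at_top)
  ultimately show "eventually (\<lambda>h. a < measure P {p \<in> space P. limit_var h p > z}) (filtercomap norm at_top)"
    by (simp add: eventually_mono)
next
  fix a :: real assume "1 < a"
  then show "eventually (\<lambda>h. measure P {p \<in> space P. limit_var h p > z} < a) (filtercomap norm at_top)"
    using P.prob_le_1 by (intro always_eventually allI) (meson le_less_trans)
qed

end

section \<open>The regression model\<close>

locale pls_regression = prob_space M
  for M :: "'w measure" and X :: "'w \<Rightarrow> 'h::{real_inner,banach,second_countable_topology}"
    and eps :: "'w \<Rightarrow> real" and \<sigma> :: real +
  assumes model: "regression_model M X eps \<sigma>"
begin

lemma X_measurable [measurable]: "X \<in> borel_measurable M"
  and eps_measurable [measurable]: "eps \<in> borel_measurable M"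
  and X_fourth: "integrable M (\<lambda>w. norm (X w) ^ 4)"
  and noise_mean: "expectation (\<lambda>w. eps w *\<^sub>R X w) = 0"
  and cond_variance: "AE w in M. nn_cond_exp M (vimage_algebra (space M) X borel)
        (\<lambda>w. ennreal ((eps w)\<^sup>2)) w \<le> ennreal (\<sigma>\<^sup>2)"
  using model by (simp_all add: regression_model_def)

lemma X_square: "integrable M (\<lambda>w. (norm (X w))\<^sup>2)"
proof (rule square_integrable_imp_integrable)
  have "(\<lambda>w. ((norm (X w))\<^sup>2)\<^sup>2) = (\<lambda>w. norm (X w) ^ 4)"
    by (simp add: power_mult[symmetric])
  then show "integrable M (\<lambda>w. ((norm (X w))\<^sup>2)\<^sup>2)" using X_fourth by simp
qed measurable

text \<open>
  Conditioning on \<open>X\<close> bounds the second moment of \<open>eps X\<close> by \<open>\<sigma>\<^sup>2 E \<parallel>X\<parallel>\<^sup>2\<close>.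
\<close>

lemma noise_square: "integrable M (\<lambda>w. (norm (eps w *\<^sub>R X w))\<^sup>2)"
proof (rule integrableI_bounded)
  define F where "F = vimage_algebra (space M) X borel"
  have sub: "subalgebra M F"
    unfolding subalgebra_def F_def using measurable_space[OF X_measurable]
    by (auto simp: sets_vimage_algebra2)
  interpret F: finite_measure_subalgebra M F by unfold_locales (rule sub)
  have [measurable]: "X \<in> borel_measurable F" unfolding F_def by (rule measurable_vimage_algebra1) simp
  have "(\<integral>\<^sup>+w. ennreal (norm ((norm (eps w *\<^sub>R X w))\<^sup>2)) \<partial>M)
      = (\<integral>\<^sup>+w. ennreal ((norm (X w))\<^sup>2) * ennreal ((eps w)\<^sup>2) \<partial>M)"
    by (intro nn_integral_cong) (simp add: power_mult_distrib ennreal_mult[symmetric] mult.commute)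
  also have "\<dots> = (\<integral>\<^sup>+w. ennreal ((norm (X w))\<^sup>2) * nn_cond_exp M F (\<lambda>w. ennreal ((eps w)\<^sup>2)) w \<partial>M)"
    by (rule F.nn_cond_exp_intg[symmetric]) measurable
  also have "\<dots> \<le> (\<integral>\<^sup>+w. ennreal ((norm (X w))\<^sup>2) * ennreal (\<sigma>\<^sup>2) \<partial>M)"
  proof (rule nn_integral_mono_AE)
    show "AE w in M. ennreal ((norm (X w))\<^sup>2) * nn_cond_exp M F (\<lambda>w. ennreal ((eps w)\<^sup>2)) w
        \<le> ennreal ((norm (X w))\<^sup>2) * ennreal (\<sigma>\<^sup>2)"
      using cond_variance unfolding F_def[symmetric] by eventually_elim (rule mult_left_mono; simp)
  qed
  also have "\<dots> = (\<integral>\<^sup>+w. ennreal ((norm (X w))\<^sup>2) \<partial>M) * ennreal (\<sigma>\<^sup>2)"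
    by (rule nn_integral_multc) measurable
  also have "\<dots> < \<infinity>"
    using nn_integral_eq_integral[OF X_square] by (simp add: ennreal_mult_less_top)
  finally show "(\<integral>\<^sup>+w. ennreal (norm ((norm (eps w *\<^sub>R X w))\<^sup>2)) \<partial>M) < \<infinity>" .
qed measurable

lemma measurable_tensor_square [measurable]:
  "(\<lambda>x. tensor_square x d) \<in> borel_measurable (borel :: 'h measure)"
  unfolding tensor_square_def by measurable

lemma norm_tensor_square_le: "norm (tensor_square x d) \<le> (norm x)\<^sup>2 * norm d"
proof -
  have "\<bar>x \<bullet> d\<bar> * norm x \<le> (norm x * norm d) * norm x"
    by (intro mult_right_mono Cauchy_Schwarz_ineq2) simp
  then show ?thesis by (simp add: tensor_square_def power2_eq_square mult_ac)
qed

lemma tensor_square_second_moment: "integrable M (\<lambda>w. (norm (tensor_square (X w) d))\<^sup>2)"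
proof (rule Bochner_Integration.integrable_bound)
  show "integrable M (\<lambda>w. norm (X w) ^ 4 * (norm d)\<^sup>2)" using X_fourth by simp
  have "(norm (tensor_square (X w) d))\<^sup>2 \<le> ((norm (X w))\<^sup>2 * norm d)\<^sup>2" for w
    by (intro power_mono norm_tensor_square_le) simp
  then show "AE w in M. norm ((norm (tensor_square (X w) d))\<^sup>2) \<le> norm (norm (X w) ^ 4 * (norm d)\<^sup>2)"
    by (simp add: power_mult_distrib power_mult[symmetric])
qed measurable

lemma tensor_square_integrable: "integrable M (\<lambda>w. tensor_square (X w) d)"
  by (rule square_norm_integrable_imp_integrable[OF prob_space_axioms _ tensor_square_second_moment])
     measurable

lemma cov_operator_0: "cov_operator M X 0 = 0"
  by (simp add: cov_operator_def tensor_square_def)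

lemma inner_var_operator:
  "u \<bullet> var_operator M X eps u = expectation (\<lambda>w. (u \<bullet> (eps w *\<^sub>R X w))\<^sup>2)"
proof -
  have eq: "(eps w)\<^sup>2 *\<^sub>R tensor_square (X w) u = (u \<bullet> (eps w *\<^sub>R X w)) *\<^sub>R (eps w *\<^sub>R X w)" for w
    by (simp add: tensor_square_def power2_eq_square inner_commute mult_ac)
  have "integrable M (\<lambda>w. (eps w)\<^sup>2 *\<^sub>R tensor_square (X w) u)"
    unfolding eq
  proof (rule Bochner_Integration.integrable_bound)
    show "integrable M (\<lambda>w. norm u * (norm (eps w *\<^sub>R X w))\<^sup>2)" using noise_square by simp
    have "\<bar>u \<bullet> y\<bar> * norm y \<le> norm u * (norm y)\<^sup>2" for y
    proof -
      have "\<bar>u \<bullet> y\<bar> * norm y \<le> (norm u * norm y) * norm y"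
        by (intro mult_right_mono Cauchy_Schwarz_ineq2) simp
      then show ?thesis by (simp add: power2_eq_square mult_ac)
    qed
    then show "AE w in M. norm ((u \<bullet> (eps w *\<^sub>R X w)) *\<^sub>R (eps w *\<^sub>R X w))
        \<le> norm (norm u * (norm (eps w *\<^sub>R X w))\<^sup>2)"
      by (intro AE_I2) (metis abs_of_nonneg mult_nonneg_nonneg norm_ge_zero norm_scaleR real_norm_def zero_le_power2)
  qed measurable
  then have "u \<bullet> var_operator M X eps u = expectation (\<lambda>w. u \<bullet> ((eps w)\<^sup>2 *\<^sub>R tensor_square (X w) u))"
    unfolding var_operator_def by (intro integral_inner_right[symmetric])
  also have "\<dots> = expectation (\<lambda>w. (u \<bullet> (eps w *\<^sub>R X w))\<^sup>2)"
    unfolding eq by (simp add: power2_eq_square mult_ac)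
  finally show ?thesis .
qed

lemma spectral_vector_noise:
  assumes "spectral_decomposition (var_operator M X eps) \<omega> \<phi>"
  shows "spectral_vector M (\<lambda>w. eps w *\<^sub>R X w) \<omega> (\<lambda>j. if \<omega> j = 0 then 0 else \<phi> j)"
proof
  let ?e = "\<lambda>j. if \<omega> j = 0 then 0 else \<phi> j"
  show "0 \<le> \<omega> j" for j using assms by (simp add: spectral_decomposition_def)
  show "?e i \<bullet> ?e j = (if i = j \<and> \<omega> i \<noteq> 0 then 1 else 0)" for i j
    using assms by (simp add: spectral_decomposition_def)
  fix u
  have "(\<lambda>j. \<omega> j *\<^sub>R tensor_square (\<phi> j) u) sums var_operator M X eps u"
    using assms by (simp add: spectral_decomposition_def)
  then have "(\<lambda>j. u \<bullet> (\<omega> j *\<^sub>R tensor_square (\<phi> j) u)) sums (u \<bullet> var_operator M X eps u)"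
    by (rule bounded_linear.sums[OF bounded_linear_inner_right])
  moreover have "u \<bullet> (\<omega> j *\<^sub>R tensor_square (\<phi> j) u) = \<omega> j * (?e j \<bullet> u)\<^sup>2" for j
    by (simp add: tensor_square_def power2_eq_square inner_commute)
  ultimately show "(\<lambda>j. \<omega> j * (?e j \<bullet> u)\<^sup>2) sums expectation (\<lambda>w. (u \<bullet> (eps w *\<^sub>R X w))\<^sup>2)"
    by (simp only: inner_var_operator)
qed (measurable, rule noise_square, rule noise_mean)

end

lemma (in prob_space) prob_norm_greater_le:
  fixes B :: "'a \<Rightarrow> 'h::{real_inner,banach,second_countable_topology}"
  assumes [measurable]: "B \<in> borel_measurable M" and int: "integrable M (\<lambda>x. (norm (B x))\<^sup>2)" and c: "0 < c"
  shows "prob {x \<in> space M. norm (B x) > c} \<le> expectation (\<lambda>x. (norm (B x))\<^sup>2) / c\<^sup>2"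
proof -
  have "prob {x \<in> space M. norm (B x) > c} \<le> prob {x \<in> space M. \<bar>norm (B x)\<bar> \<ge> c}"
    by (intro finite_measure_mono) auto
  also have "\<dots> \<le> expectation (\<lambda>x. (norm (B x))\<^sup>2) / c\<^sup>2"
    by (rule second_moment_method[OF _ int c]) measurable
  finally show ?thesis .
qed

section \<open>Rejection probabilities\<close>

locale pls_sample = pls_regression M X eps \<sigma>
  for M :: "'w measure" and X :: "'w \<Rightarrow> 'h::{real_inner,banach,second_countable_topology}"
    and eps \<sigma> +
  fixes \<beta> :: "nat \<Rightarrow> 'h" and S :: "nat \<Rightarrow> 's measure"
    and Xs :: "nat \<Rightarrow> nat \<Rightarrow> 's \<Rightarrow> 'h" and Ys :: "nat \<Rightarrow> nat \<Rightarrow> 's \<Rightarrow> real" and m :: "nat \<Rightarrow> 's \<Rightarrow> nat"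
  assumes sampling: "pls_sampling M X eps \<beta> S Xs Ys m"
begin

definition noise :: "nat \<Rightarrow> nat \<Rightarrow> 's \<Rightarrow> 'h" where
  "noise n i s = (Ys n i s - \<beta> n \<bullet> Xs n i s) *\<^sub>R Xs n i s"

definition cov_error :: "'h \<Rightarrow> nat \<Rightarrow> nat \<Rightarrow> 's \<Rightarrow> 'h" where
  "cov_error d n i s = tensor_square (Xs n i s) d - cov_operator M X d"

definition residual :: "nat \<Rightarrow> 's \<Rightarrow> 'h" where
  "residual n s = sample_r n (\<lambda>i. Xs n i s) (\<lambda>i. Ys n i s)
     - sample_K n (\<lambda>i. Xs n i s) (pls_estimator (m n s) n (\<lambda>i. Xs n i s) (\<lambda>i. Ys n i s))"

definition deviation :: "'h \<Rightarrow> nat \<Rightarrow> 's \<Rightarrow> 'h" where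
  "deviation b n s = sqrt (real n) *\<^sub>R
     sample_K n (\<lambda>i. Xs n i s) (pls_estimator (m n s) n (\<lambda>i. Xs n i s) (\<lambda>i. Ys n i s) - b)"

lemma pls_statistic_eq:
  "pls_statistic b (m n s) n (\<lambda>i. Xs n i s) (\<lambda>i. Ys n i s) = (norm (deviation b n s))\<^sup>2"
  by (simp add: pls_statistic_def deviation_def power_mult_distrib)

lemma iid_pairs:
  "1 \<le> n \<Longrightarrow> iid_copies (S n) n (\<lambda>i s. (Xs n i s, Ys n i s)) M (\<lambda>w. (X w, \<beta> n \<bullet> X w + eps w))"
  using sampling by (simp add: pls_sampling_def)

lemma prob_space_S: "1 \<le> n \<Longrightarrow> prob_space (S n)"
  using iid_pairs by (simp add: iid_copies_def)

lemma pair_measurable: "(\<lambda>w. (X w, \<beta> n \<bullet> X w + eps w)) \<in> borel_measurable M"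
  by measurable

lemma iid_transform:
  assumes "1 \<le> n" and f: "continuous_on UNIV (\<lambda>v. f (fst v) (snd v))"
  shows "iid_copies (S n) n (\<lambda>i s. f (Xs n i s) (Ys n i s)) M (\<lambda>w. f (X w) (\<beta> n \<bullet> X w + eps w))"
  using iid_copies_compose[OF iid_pairs[OF assms(1)] pair_measurable borel_measurable_continuous_onI[OF f]]
  by simp

lemma iid_noise:
  assumes n: "1 \<le> n"
  shows "iid_copies (S n) n (noise n) M (\<lambda>w. eps w *\<^sub>R X w)"
proof -
  have "continuous_on UNIV (\<lambda>v. (snd v - \<beta> n \<bullet> fst v) *\<^sub>R fst v)"
    by (intro continuous_intros)
  from iid_transform[of n "\<lambda>x y. (y - \<beta> n \<bullet> x) *\<^sub>R x", OF n this] show ?thesis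
    by (simp add: noise_def[abs_def])
qed

lemma iid_cov_error:
  assumes n: "1 \<le> n"
  shows "iid_copies (S n) n (cov_error d n) M (\<lambda>w. tensor_square (X w) d - cov_operator M X d)"
proof -
  have "continuous_on UNIV (\<lambda>v :: 'h \<times> real. tensor_square (fst v) d - cov_operator M X d)"
    unfolding tensor_square_def by (intro continuous_intros)
  from iid_transform[of n "\<lambda>x y. tensor_square x d - cov_operator M X d", OF n this] show ?thesis
    by (simp add: cov_error_def[abs_def])
qed

lemma cov_error_population:
  "integrable M (\<lambda>w. (norm (tensor_square (X w) d - cov_operator M X d))\<^sup>2)"
  "expectation (\<lambda>w. tensor_square (X w) d - cov_operator M X d) = 0"
proof -
  show "integrable M (\<lambda>w. (norm (tensor_square (X w) d - cov_operator M X d))\<^sup>2)"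
  proof (rule Bochner_Integration.integrable_bound)
    show "integrable M (\<lambda>w. 2 * (norm (tensor_square (X w) d))\<^sup>2 + 2 * (norm (cov_operator M X d))\<^sup>2)"
      using tensor_square_second_moment by simp
    have "(norm (x - y))\<^sup>2 \<le> 2 * (norm x)\<^sup>2 + 2 * (norm y)\<^sup>2" for x y :: 'h
    proof -
      have "(norm (x - y))\<^sup>2 + (norm (x + y))\<^sup>2 = 2 * (norm x)\<^sup>2 + 2 * (norm y)\<^sup>2"
        by (simp add: power2_norm_eq_inner inner_diff_left inner_diff_right inner_add_left inner_add_right)
      then show ?thesis using zero_le_power2[of "norm (x + y)"] by linarith
    qed
    then show "AE w in M. norm ((norm (tensor_square (X w) d - cov_operator M X d))\<^sup>2)
        \<le> norm (2 * (norm (tensor_square (X w) d))\<^sup>2 + 2 * (norm (cov_operator M X d))\<^sup>2)"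
      by simp
  qed measurable
  show "expectation (\<lambda>w. tensor_square (X w) d - cov_operator M X d) = 0"
    using tensor_square_integrable by (simp add: cov_operator_def prob_space)
qed

lemma measurable_Xs: "1 \<le> n \<Longrightarrow> i \<in> {1..n} \<Longrightarrow> Xs n i \<in> borel_measurable (S n)"
  using iid_copies_measurable[OF iid_transform[of n "\<lambda>x y. x"]] by (simp add: continuous_on_fst)

lemma measurable_Ys: "1 \<le> n \<Longrightarrow> i \<in> {1..n} \<Longrightarrow> Ys n i \<in> borel_measurable (S n)"
  using iid_copies_measurable[OF iid_transform[of n "\<lambda>x y. y"]] by (simp add: continuous_on_snd)

lemma measurable_fit:
  "1 \<le> n \<Longrightarrow> (\<lambda>s. sample_K n (\<lambda>i. Xs n i s) (pls_estimator (m n s) n (\<lambda>i. Xs n i s) (\<lambda>i. Ys n i s)))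
      \<in> borel_measurable (S n)"
  using sampling
  by (intro borel_measurable_pls_fit measurable_Xs measurable_Ys) (simp_all add: pls_sampling_def)

lemma measurable_deviation:
  assumes n: "1 \<le> n"
  shows "deviation b n \<in> borel_measurable (S n)"
proof -
  note [measurable] = measurable_fit[OF n] borel_measurable_sample_K[OF measurable_Xs[OF n] borel_measurable_const]
  show ?thesis
    unfolding deviation_def[abs_def] linear_diff[OF linear_sample_K] by measurable
qed

lemma measurable_residual:
  assumes n: "1 \<le> n"
  shows "residual n \<in> borel_measurable (S n)"
proof -
  note [measurable] = measurable_fit[OF n] borel_measurable_sample_r[OF measurable_Xs[OF n] measurable_Ys[OF n]]
  show ?thesis unfolding residual_def[abs_def] by measurable
qed

text \<open>
  The estimation error of the covariance operator in a fixed direction, multiplied by \<open>sqrt n\<close>, is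
  itself a normalized sum of centred vectors and hence bounded in probability.
\<close>

lemma sample_K_eq:
  assumes n: "1 \<le> n"
  shows "sqrt (real n) *\<^sub>R sample_K n (\<lambda>i. Xs n i s) d
     = sqrt (real n) *\<^sub>R cov_operator M X d + normalized_sum n (\<lambda>i. cov_error d n i s)"
proof -
  have "normalized_sum n (\<lambda>i. cov_error d n i s)
      = (1 / sqrt (real n)) *\<^sub>R (\<Sum>i=1..n. tensor_square (Xs n i s) d)
        - (real n / sqrt (real n)) *\<^sub>R cov_operator M X d"
    by (simp add: normalized_sum_def cov_error_def sum_subtractf scaleR_diff_right sum_constant_scaleR)
  moreover have "sqrt (real n) / real n = 1 / sqrt (real n)" "real n / sqrt (real n) = sqrt (real n)"
    using n by (simp_all add: field_simps)
  ultimately show ?thesis by (simp add: sample_K_def)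
qed

text \<open>
  The decomposition on which the test rests. The empirical normal equation
  \<open>r = K (\<beta> n) + noise\<close> is exact, and the estimator satisfies it up to the residual.
  So the choice of the Krylov space matters only through the size of the residual.
\<close>

lemma deviation_eq:
  assumes n: "1 \<le> n"
  shows "deviation b n s = normalized_sum n (\<lambda>i. noise n i s) - sqrt (real n) *\<^sub>R residual n s
      + sqrt (real n) *\<^sub>R sample_K n (\<lambda>i. Xs n i s) (\<beta> n - b)"
proof -
  let ?K = "sample_K n (\<lambda>i. Xs n i s)"
  have "noise n i s = Ys n i s *\<^sub>R Xs n i s - tensor_square (Xs n i s) (\<beta> n)" for i
    by (simp add: noise_def tensor_square_def scaleR_diff_left inner_commute)
  then have "normalized_sum n (\<lambda>i. noise n i s)
      = (1 / sqrt (real n)) *\<^sub>R ((\<Sum>i=1..n. Ys n i s *\<^sub>R Xs n i s) - (\<Sum>i=1..n. tensor_square (Xs n i s) (\<beta> n)))"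
    by (simp add: normalized_sum_def sum_subtractf)
  also have "\<dots> = sqrt (real n) *\<^sub>R (sample_r n (\<lambda>i. Xs n i s) (\<lambda>i. Ys n i s) - ?K (\<beta> n))"
  proof -
    have "sqrt (real n) / real n = 1 / sqrt (real n)" using n by (simp add: field_simps)
    then show ?thesis by (simp add: sample_r_def sample_K_def scaleR_diff_right)
  qed
  finally have G: "normalized_sum n (\<lambda>i. noise n i s)
      = sqrt (real n) *\<^sub>R (sample_r n (\<lambda>i. Xs n i s) (\<lambda>i. Ys n i s) - ?K (\<beta> n))" .
  show ?thesis
    unfolding G deviation_def residual_def linear_diff[OF linear_sample_K]
    by (simp add: algebra_simps)
qed

lemma residual_small:
  assumes c: "0 < c"
  shows "(\<lambda>n. measure (S (Suc n)) {s \<in> space (S (Suc n)). norm (sqrt (real (Suc n)) *\<^sub>R residual (Suc n) s) > c}) \<longlonglongrightarrow> 0"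
proof -
  have "(\<lambda>n. measure (S n) {s \<in> space (S n). \<bar>norm (residual n s)\<bar> > c * real n powr (-1/2)}) \<longlonglongrightarrow> 0"
    using sampling c unfolding pls_sampling_def small_oP_def pls_residual_def residual_def by blast
  from LIMSEQ_Suc[OF this]
  have "(\<lambda>n. measure (S (Suc n)) {s \<in> space (S (Suc n)). \<bar>norm (residual (Suc n) s)\<bar> > c * real (Suc n) powr (-1/2)}) \<longlonglongrightarrow> 0" .
  moreover have "\<bar>norm (residual (Suc n) s)\<bar> > c * real (Suc n) powr (-1/2)
      \<longleftrightarrow> norm (sqrt (real (Suc n)) *\<^sub>R residual (Suc n) s) > c" for n s
  proof -
    have "real (Suc n) powr (-1/2) = 1 / sqrt (real (Suc n))"
      by (simp add: powr_minus_divide powr_half_sqrt)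
    moreover have "0 < sqrt (real (Suc n))" by simp
    ultimately show ?thesis by (simp add: pos_divide_less_eq mult.commute del: of_nat_Suc)
  qed
  ultimately show ?thesis by (simp only:)
qed

text \<open>
  The deviation is \<open>sqrt n * K \<delta>\<close> plus terms that are bounded in probability, so with
  probability tending to 1 its norm exceeds any fixed bound.
\<close>

theorem rejection_prob_fixed_alternative:
  assumes \<beta>: "\<And>n. \<beta> n = b + \<delta>" and K: "cov_operator M X \<delta> \<noteq> 0"
  shows "rejection_prob b z S Xs Ys m \<longlonglongrightarrow> 1"
proof (rule LIMSEQ_imp_Suc)
  define \<kappa> where "\<kappa> = norm (cov_operator M X \<delta>)"
  have \<kappa>: "0 < \<kappa>" using K by (simp add: \<kappa>_def)
  define A where "A n s = normalized_sum (Suc n) (\<lambda>i. noise (Suc n) i s)" for n s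
  define B where "B n s = normalized_sum (Suc n) (\<lambda>i. cov_error \<delta> (Suc n) i s)" for n s
  define R where "R n s = sqrt (real (Suc n)) *\<^sub>R residual (Suc n) s" for n s
  let ?P = "\<lambda>n. measure (S (Suc n))"
  \<comment> \<open>A quarter of the norm of the drift, which outweighs each of \<open>A\<close>, \<open>B\<close> and the residual
      term with high probability; the last quarter remains for the deviation.\<close>
  define q where "q n = \<kappa> / 4 * sqrt (real (Suc n))" for n
  have q: "0 < q n" for n using \<kappa> by (simp add: q_def)
  have mA [measurable]: "A n \<in> borel_measurable (S (Suc n))" for n
    unfolding A_def[abs_def] by (rule borel_measurable_normalized_sum[OF iid_noise]) simp
  have mB [measurable]: "B n \<in> borel_measurable (S (Suc n))" for n
    unfolding B_def[abs_def] by (rule borel_measurable_normalized_sum[OF iid_cov_error]) simp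
  have mR [measurable]: "R n \<in> borel_measurable (S (Suc n))" for n
    unfolding R_def[abs_def] using measurable_residual[of "Suc n"] by measurable
  have mD [measurable]: "deviation b (Suc n) \<in> borel_measurable (S (Suc n))" for n
    by (rule measurable_deviation) simp
  define CA where "CA = expectation (\<lambda>w. (norm (eps w *\<^sub>R X w))\<^sup>2)"
  define CB where "CB = expectation (\<lambda>w. (norm (tensor_square (X w) \<delta> - cov_operator M X \<delta>))\<^sup>2)"
  have PA: "?P n {s \<in> space (S (Suc n)). norm (A n s) > q n} \<le> CA / (q n)\<^sup>2" for n
  proof -
    interpret S: prob_space "S (Suc n)" by (rule prob_space_S) simp
    have *: "iid_copies (S (Suc n)) (Suc n) (noise (Suc n)) M (\<lambda>w. eps w *\<^sub>R X w)"
      by (rule iid_noise) simp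
    have i: "integrable (S (Suc n)) (\<lambda>s. (norm (A n s))\<^sup>2)"
      and e: "S.expectation (\<lambda>s. (norm (A n s))\<^sup>2) = CA"
      using normalized_sum_second_moment[OF * _ _ noise_square noise_mean]
      by (simp_all add: A_def CA_def)
    show ?thesis using S.prob_norm_greater_le[OF mA i q[of n]] by (simp add: e)
  qed
  have PB: "?P n {s \<in> space (S (Suc n)). norm (B n s) > q n} \<le> CB / (q n)\<^sup>2" for n
  proof -
    interpret S: prob_space "S (Suc n)" by (rule prob_space_S) simp
    have *: "iid_copies (S (Suc n)) (Suc n) (cov_error \<delta> (Suc n)) M
        (\<lambda>w. tensor_square (X w) \<delta> - cov_operator M X \<delta>)"
      by (rule iid_cov_error) simp
    have i: "integrable (S (Suc n)) (\<lambda>s. (norm (B n s))\<^sup>2)"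
      and e: "S.expectation (\<lambda>s. (norm (B n s))\<^sup>2) = CB"
      using normalized_sum_second_moment[OF * _ _ cov_error_population]
      by (simp_all add: B_def CB_def)
    show ?thesis using S.prob_norm_greater_le[OF mB i q[of n]] by (simp add: e)
  qed
  have q_top: "filterlim q at_top sequentially"
    unfolding q_def[abs_def]
    by (rule filterlim_tendsto_pos_mult_at_top[OF tendsto_const _ filterlim_compose[OF sqrt_at_top
          filterlim_compose[OF filterlim_real_sequentially filterlim_Suc]]]) (use \<kappa> in simp)
  have "(\<lambda>n. (CA + CB) / (q n)\<^sup>2) \<longlonglongrightarrow> 0"
    using q_top by (intro tendsto_divide_0[OF tendsto_const] filterlim_at_top_imp_at_infinity
        filterlim_pow_at_top) simp_all
  then have err: "(\<lambda>n. 1 - ((CA + CB) / (q n)\<^sup>2 + ?P n {s \<in> space (S (Suc n)). norm (R n s) > 1})) \<longlonglongrightarrow> 1 - (0 + 0)"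
    unfolding R_def by (intro tendsto_diff tendsto_add tendsto_const residual_small) simp_all
  show "(\<lambda>n. rejection_prob b z S Xs Ys m (Suc n)) \<longlonglongrightarrow> 1"
  proof (rule tendsto_sandwich[OF _ _ _ tendsto_const])
    show "(\<lambda>n. 1 - ((CA + CB) / (q n)\<^sup>2 + ?P n {s \<in> space (S (Suc n)). norm (R n s) > 1})) \<longlonglongrightarrow> 1"
      using err by simp
    show "eventually (\<lambda>n. rejection_prob b z S Xs Ys m (Suc n) \<le> 1) sequentially"
      unfolding rejection_prob_def using prob_space_S
      by (intro always_eventually allI prob_space.prob_le_1) simp
    have "eventually (\<lambda>n. \<bar>z\<bar> + 1 \<le> q n) sequentially" and "eventually (\<lambda>n. 1 \<le> q n) sequentially"
      using q_top by (simp_all add: filterlim_at_top)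
    then show "eventually (\<lambda>n. 1 - ((CA + CB) / (q n)\<^sup>2 + ?P n {s \<in> space (S (Suc n)). norm (R n s) > 1})
        \<le> rejection_prob b z S Xs Ys m (Suc n)) sequentially"
    proof eventually_elim
      case (elim n)
      interpret S: prob_space "S (Suc n)" by (rule prob_space_S) simp
      let ?rej = "{s \<in> space (S (Suc n)). (norm (deviation b (Suc n) s))\<^sup>2 > z}"
      let ?A = "{s \<in> space (S (Suc n)). norm (A n s) > q n}"
      let ?B = "{s \<in> space (S (Suc n)). norm (B n s) > q n}"
      let ?R = "{s \<in> space (S (Suc n)). norm (R n s) > 1}"
      have cover: "space (S (Suc n)) - ?rej \<subseteq> ?A \<union> ?B \<union> ?R"
      proof (rule subsetI, rule ccontr)
        fix s assume s: "s \<in> space (S (Suc n)) - ?rej" "s \<notin> ?A \<union> ?B \<union> ?R"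
        then have le: "norm (A n s) \<le> q n" "norm (B n s) \<le> q n" "norm (R n s) \<le> 1"
          and T: "(norm (deviation b (Suc n) s))\<^sup>2 \<le> z" by auto
        have "deviation b (Suc n) s = A n s - R n s + (sqrt (real (Suc n)) *\<^sub>R cov_operator M X \<delta> + B n s)"
          using deviation_eq[of "Suc n" b s] sample_K_eq[of "Suc n" s \<delta>]
          by (simp add: A_def B_def R_def \<beta>)
        then have eq: "sqrt (real (Suc n)) *\<^sub>R cov_operator M X \<delta>
            = deviation b (Suc n) s - A n s + R n s - B n s"
          by simp
        have "norm (sqrt (real (Suc n)) *\<^sub>R cov_operator M X \<delta>)
            \<le> norm (deviation b (Suc n) s) + norm (A n s) + norm (R n s) + norm (B n s)"
          unfolding eq using norm_triangle_ineq4[of "deviation b (Suc n) s" "A n s"]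
            norm_triangle_ineq[of "deviation b (Suc n) s - A n s" "R n s"]
            norm_triangle_ineq4[of "deviation b (Suc n) s - A n s + R n s" "B n s"]
          by linarith
        moreover have "norm (sqrt (real (Suc n)) *\<^sub>R cov_operator M X \<delta>) = 4 * q n"
          by (simp add: q_def \<kappa>_def)
        ultimately have "q n \<le> norm (deviation b (Suc n) s)" using le elim(2) by linarith
        then have "(q n)\<^sup>2 \<le> z" using T q[of n] by (meson less_imp_le order_trans power_mono)
        moreover have "q n * 1 \<le> (q n)\<^sup>2" unfolding power2_eq_square using elim(2) by (intro mult_left_mono) auto
        ultimately show False using elim(1) by linarith
      qed
      have "1 - S.prob ?rej = S.prob (space (S (Suc n)) - ?rej)"
        by (rule S.prob_compl[symmetric]) measurable
      also have "\<dots> \<le> S.prob (?A \<union> ?B \<union> ?R)" by (rule S.finite_measure_mono[OF cover]) measurable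
      also have "\<dots> \<le> S.prob ?A + S.prob ?B + S.prob ?R"
        by (intro order_trans[OF measure_Un_le] add_mono measure_Un_le order_refl) measurable
      also have "\<dots> \<le> CA / (q n)\<^sup>2 + CB / (q n)\<^sup>2 + S.prob ?R"
        using PA PB by (intro add_mono) auto
      finally show ?case unfolding rejection_prob_def pls_statistic_eq by (simp add: add_divide_distrib)
    qed
  qed
qed

end

text \<open>
  For coefficients at distance of order \<open>1 / sqrt n\<close> from \<open>b\<close> the drift \<open>sqrt n * K (\<beta> n - b)\<close>
  stays bounded and converges to \<open>K \<Delta>\<close>, which shifts the Gaussian limit. The null
  hypothesis is the case \<open>\<Delta> = 0\<close>.
\<close>

theorem (in pls_sample) rejection_prob_local_alternative:
  assumes \<beta>: "\<And>n. \<beta> n = b + (real n powr (-1/2)) *\<^sub>R \<Delta>"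
    and clt: "hilbert_clt M (\<lambda>w. eps w *\<^sub>R X w) \<omega> e P Z"
    and J: "\<omega> J \<noteq> 0"
  shows "rejection_prob b z S Xs Ys m \<longlonglongrightarrow>
     measure P {p \<in> space P. hilbert_clt.limit_var \<omega> e Z (cov_operator M X \<Delta>) p > z}"
proof (rule LIMSEQ_imp_Suc)
  interpret H: hilbert_clt M "\<lambda>w. eps w *\<^sub>R X w" \<omega> e P Z by (rule clt)
  define KD where "KD = cov_operator M X \<Delta>"
  define C where "C = expectation (\<lambda>w. (norm (tensor_square (X w) \<Delta> - KD))\<^sup>2)"
  show "(\<lambda>n. rejection_prob b z S Xs Ys m (Suc n)) \<longlonglongrightarrow>
     measure P {p \<in> space P. H.limit_var (cov_operator M X \<Delta>) p > z}"
    unfolding rejection_prob_def pls_statistic_eq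
  proof (rule H.norm_square_prob_tendsto[OF iid_noise measurable_deviation])
    show "measure P {p \<in> space P. H.limit_var (cov_operator M X \<Delta>) p = z} = 0"
      by (rule H.limit_var_no_atom[OF J])
    fix c :: real assume c: "0 < c"
    define R where "R n s = sqrt (real (Suc n)) *\<^sub>R residual (Suc n) s" for n s
    define B where "B n s = normalized_sum (Suc n) (\<lambda>i. cov_error \<Delta> (Suc n) i s)" for n s
    let ?D = "\<lambda>n s. deviation b (Suc n) s - (normalized_sum (Suc n) (\<lambda>i. noise (Suc n) i s) + cov_operator M X \<Delta>)"
    let ?P = "\<lambda>n. measure (S (Suc n))"
    have D: "?D n s = (1 / sqrt (real (Suc n))) *\<^sub>R B n s - R n s" for n s
    proof -
      have Suc1: "1 \<le> Suc n" by simp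
      have "\<beta> (Suc n) - b = (1 / sqrt (real (Suc n))) *\<^sub>R \<Delta>"
        by (simp add: \<beta> powr_minus_divide powr_half_sqrt)
      then have "sqrt (real (Suc n)) *\<^sub>R sample_K (Suc n) (\<lambda>i. Xs (Suc n) i s) (\<beta> (Suc n) - b)
          = (1 / sqrt (real (Suc n))) *\<^sub>R (sqrt (real (Suc n)) *\<^sub>R sample_K (Suc n) (\<lambda>i. Xs (Suc n) i s) \<Delta>)"
        by (simp add: linear_cmul[OF linear_sample_K])
      also have "\<dots> = KD + (1 / sqrt (real (Suc n))) *\<^sub>R B n s"
        unfolding sample_K_eq[OF Suc1] by (simp add: KD_def B_def scaleR_add_right)
      finally show ?thesis
        unfolding deviation_eq[OF Suc1] by (simp add: R_def KD_def)
    qed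
    have mB [measurable]: "B n \<in> borel_measurable (S (Suc n))" for n
      unfolding B_def[abs_def] by (rule borel_measurable_normalized_sum[OF iid_cov_error]) simp
    have mR [measurable]: "R n \<in> borel_measurable (S (Suc n))" for n
      unfolding R_def[abs_def] using measurable_residual[of "Suc n"] by measurable
    have bound: "?P n {s \<in> space (S (Suc n)). norm (?D n s) > c}
       \<le> C / ((c / 2)\<^sup>2 * real (Suc n)) + ?P n {s \<in> space (S (Suc n)). norm (R n s) > c / 2}" for n
    proof -
      interpret S: prob_space "S (Suc n)" by (rule prob_space_S) simp
      define r where "r = c / 2 * sqrt (real (Suc n))"
      have r: "0 < r" using c by (simp add: r_def)
      have r2: "r\<^sup>2 = (c / 2)\<^sup>2 * real (Suc n)"
        unfolding r_def power_mult_distrib by (simp only: real_sqrt_pow2[OF of_nat_0_le_iff])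
      have *: "iid_copies (S (Suc n)) (Suc n) (cov_error \<Delta> (Suc n)) M
          (\<lambda>w. tensor_square (X w) \<Delta> - cov_operator M X \<Delta>)"
        by (rule iid_cov_error) simp
      have i: "integrable (S (Suc n)) (\<lambda>s. (norm (B n s))\<^sup>2)"
        and e: "S.expectation (\<lambda>s. (norm (B n s))\<^sup>2) = C"
        using normalized_sum_second_moment[OF * _ _ cov_error_population]
        by (simp_all add: B_def C_def KD_def)
      let ?B = "{s \<in> space (S (Suc n)). norm (B n s) > r}"
      let ?R = "{s \<in> space (S (Suc n)). norm (R n s) > c / 2}"
      have "{s \<in> space (S (Suc n)). norm (?D n s) > c} \<subseteq> ?B \<union> ?R"
      proof (rule subsetI, rule ccontr)
        fix s assume s: "s \<in> {s \<in> space (S (Suc n)). norm (?D n s) > c}" "s \<notin> ?B \<union> ?R"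
        then have le: "norm (B n s) \<le> r" "norm (R n s) \<le> c / 2" by auto
        have "norm ((1 / sqrt (real (Suc n))) *\<^sub>R B n s) \<le> c / 2"
          using le(1) by (simp add: r_def field_simps)
        then have "norm (?D n s) \<le> c / 2 + c / 2"
          unfolding D using le(2) by (intro order_trans[OF norm_triangle_ineq4] add_mono)
        then show False using s by simp
      qed
      then have "S.prob {s \<in> space (S (Suc n)). norm (?D n s) > c} \<le> S.prob (?B \<union> ?R)"
        by (rule S.finite_measure_mono) measurable
      also have "\<dots> \<le> S.prob ?B + S.prob ?R" by (rule measure_Un_le) measurable
      also have "\<dots> \<le> C / r\<^sup>2 + S.prob ?R"
        using S.prob_norm_greater_le[OF mB i r] unfolding e by (rule add_right_mono)
      finally show ?thesis unfolding r2 .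
    qed
    have "(\<lambda>n. (C / (c / 2)\<^sup>2) / real (Suc n)) \<longlonglongrightarrow> 0"
      using LIMSEQ_Suc[OF lim_const_over_n[of "C / (c / 2)\<^sup>2"]] by simp
    then have "(\<lambda>n. C / ((c / 2)\<^sup>2 * real (Suc n))) \<longlonglongrightarrow> 0"
      by (simp only: divide_divide_eq_left)
    moreover have "(\<lambda>n. ?P n {s \<in> space (S (Suc n)). norm (R n s) > c / 2}) \<longlonglongrightarrow> 0"
      unfolding R_def using c by (intro residual_small) simp
    ultimately have "(\<lambda>n. C / ((c / 2)\<^sup>2 * real (Suc n)) + ?P n {s \<in> space (S (Suc n)). norm (R n s) > c / 2}) \<longlonglongrightarrow> 0"
      by (auto intro: tendsto_add_zero)
    then show "(\<lambda>n. ?P n {s \<in> space (S (Suc n)). norm (?D n s) > c}) \<longlonglongrightarrow> 0"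
      by (rule Lim_null_comparison[rotated]) (use bound in \<open>simp add: always_eventually\<close>)
  qed simp_all
qed

theorem corollary1:
  fixes M :: "'w measure"
    and X :: "'w \<Rightarrow> 'h::{real_inner,banach,second_countable_topology}"
    and eps :: "'w \<Rightarrow> real"
    and \<sigma> \<alpha> z :: real
    and b :: 'h
    and \<omega> :: "nat \<Rightarrow> real"
    and \<phi> :: "nat \<Rightarrow> 'h"
    and P :: "'p measure"
    and Z :: "nat \<Rightarrow> 'p \<Rightarrow> real"
  assumes model: "regression_model M X eps \<sigma>"
    and no_zero_eigenvalue: "\<not> is_eigenvalue (cov_operator M X) 0"
    and spectral: "spectral_decomposition (var_operator M X eps) \<omega> \<phi>"
    and prob_P: "prob_space P"
    and Z_indep: "prob_space.indep_vars P (\<lambda>_. borel) Z UNIV"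
    and Z_normal: "\<And>j. distributed P lborel (Z j) std_normal_density"
    and alpha: "0 < \<alpha>" "\<alpha> < 1"
    and quantile: "measure P {p \<in> space P. (\<Sum>j. \<omega> j * (Z j p)\<^sup>2) \<le> z} = 1 - \<alpha>"
  shows
    "(\<forall>\<beta> (S :: nat \<Rightarrow> 's measure) Xs Ys m.
        \<beta> = b \<and> pls_sampling M X eps (\<lambda>n. \<beta>) S Xs Ys m
        \<longrightarrow> rejection_prob b z S Xs Ys m \<longlonglongrightarrow> \<alpha>)
     \<and>
     (\<forall>\<beta> (S :: nat \<Rightarrow> 's measure) Xs Ys m.
        \<beta> \<noteq> b \<and> pls_sampling M X eps (\<lambda>n. \<beta>) S Xs Ys m
        \<longrightarrow> rejection_prob b z S Xs Ys m \<longlonglongrightarrow> 1)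
     \<and>
     (\<exists>L :: 'h \<Rightarrow> real.
        (\<forall>\<Delta> (S :: nat \<Rightarrow> 's measure) Xs Ys m.
           pls_sampling M X eps (\<lambda>n. b + (real n powr (-1/2)) *\<^sub>R \<Delta>) S Xs Ys m
           \<longrightarrow> rejection_prob b z S Xs Ys m \<longlonglongrightarrow> L \<Delta>) \<and>
        (\<forall>\<Delta>. L \<Delta> \<le> 1) \<and>
        (L \<longlongrightarrow> 1) (filtercomap (\<lambda>\<Delta>. norm (cov_operator M X \<Delta>)) at_top))"
proof -
  have M: "prob_space M" using model by (simp add: regression_model_def)
  interpret prob_space M by (rule M)
  interpret pls_regression M X eps \<sigma> by unfold_locales (rule model)
  interpret P: prob_space P by (rule prob_P)
  define e where "e = (\<lambda>j. if \<omega> j = 0 then 0 else \<phi> j)"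
  have G: "gaussian_sequence P Z" by unfold_locales (rule Z_indep, rule Z_normal)
  have clt: "hilbert_clt M (\<lambda>w. eps w *\<^sub>R X w) \<omega> e P Z"
    unfolding e_def by (intro hilbert_clt.intro spectral_vector_noise spectral G)
  interpret H: hilbert_clt M "\<lambda>w. eps w *\<^sub>R X w" \<omega> e P Z by (rule clt)
  define L where "L \<Delta> = measure P {p \<in> space P. H.limit_var (cov_operator M X \<Delta>) p > z}" for \<Delta>
  \<comment> \<open>Otherwise the limit variable would vanish identically and have no quantile of a level strictly
      between 0 and 1.\<close>
  obtain J where J: "\<omega> J \<noteq> 0"
  proof (rule ccontr)
    assume "\<not> thesis"
    then have "\<And>j. \<omega> j = 0" using that by blast
    then have "measure P {p \<in> space P. (0::real) \<le> z} = 1 - \<alpha>" using quantile by simp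
    then show False using alpha by (cases "0 \<le> z") (simp_all add: P.prob_space)
  qed
  have local: "rejection_prob b z S Xs Ys m \<longlonglongrightarrow> L \<Delta>"
    if "pls_sampling M X eps (\<lambda>n. b + (real n powr (-1/2)) *\<^sub>R \<Delta>) S Xs Ys m"
    for \<Delta> and S :: "nat \<Rightarrow> 's measure" and Xs Ys m
  proof -
    interpret pls_sample M X eps \<sigma> "\<lambda>n. b + (real n powr (-1/2)) *\<^sub>R \<Delta>" S Xs Ys m
      by unfold_locales (rule that)
    show ?thesis unfolding L_def by (rule rejection_prob_local_alternative[OF refl clt J])
  qed
  have L0: "L 0 = \<alpha>"
  proof -
    have T: "H.limit_var 0 p = (\<Sum>j. \<omega> j * (Z j p)\<^sup>2)" for p
      by (simp add: H.limit_var_def H.limit_term_def)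
    have [measurable]: "(\<lambda>p. \<Sum>j. \<omega> j * (Z j p)\<^sup>2) \<in> borel_measurable P"
      using H.measurable_limit_var[of 0] unfolding T .
    have "L 0 = P.prob (space P - {p \<in> space P. (\<Sum>j. \<omega> j * (Z j p)\<^sup>2) \<le> z})"
      unfolding L_def cov_operator_0 T by (rule arg_cong[where f = P.prob]) auto
    also have "\<dots> = \<alpha>" by (subst P.prob_compl) (simp_all add: quantile)
    finally show ?thesis .
  qed
  have "rejection_prob b z S Xs Ys m \<longlonglongrightarrow> \<alpha>"
    if "pls_sampling M X eps (\<lambda>n. b) S Xs Ys m" for S :: "nat \<Rightarrow> 's measure" and Xs Ys m
    using local[of 0 S Xs Ys m] that by (simp add: L0)
  moreover have "rejection_prob b z S Xs Ys m \<longlonglongrightarrow> 1"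
    if \<beta>: "\<beta> \<noteq> b" and s: "pls_sampling M X eps (\<lambda>n. \<beta>) S Xs Ys m"
    for \<beta> and S :: "nat \<Rightarrow> 's measure" and Xs Ys m
  proof -
    interpret pls_sample M X eps \<sigma> "\<lambda>n. \<beta>" S Xs Ys m by unfold_locales (rule s)
    have "cov_operator M X (\<beta> - b) \<noteq> 0"
    proof
      assume "cov_operator M X (\<beta> - b) = 0"
      then have "is_eigenvalue (cov_operator M X) 0"
        unfolding is_eigenvalue_def using \<beta> by (intro exI[of _ "\<beta> - b"]) simp
      with no_zero_eigenvalue show False ..
    qed
    then show ?thesis by (intro rejection_prob_fixed_alternative[where \<delta> = "\<beta> - b"]) simp_all
  qed
  moreover have "L \<Delta> \<le> 1" for \<Delta> by (simp add: L_def)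
  moreover have "(L \<longlongrightarrow> 1) (filtercomap (\<lambda>\<Delta>. norm (cov_operator M X \<Delta>)) at_top)"
  proof -
    have "filterlim (cov_operator M X) (filtercomap norm at_top)
        (filtercomap (\<lambda>\<Delta>. norm (cov_operator M X \<Delta>)) at_top)"
      by (simp add: filterlim_filtercomap_iff comp_def filterlim_filtercomap)
    from filterlim_compose[OF H.limit_prob_tendsto_1 this] show ?thesis by (simp add: L_def[abs_def])
  qed
  ultimately show ?thesis using local by blast
qed

end
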